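(* Let $X$ be a complex Banach space which is an $M$-ideal in its bidual $X^{**}$ under the canonical embedding. Let $\tau\in X^{**}$ be such that $d(\tau,X)<\|\tau\|$. Then $\tau$ attains its norm (as a functional on $X^*$, i.e. there is $g\in X^*$ with $\|g\|=1$ and $\tau(g)=\|\tau\|$). Moreover, the subdifferential set of $\tau$ has the same description in all higher odd-order duals of $X$: for every $n\ge1$, regarding $\tau$ as an element of $X^{(2n)}$ via the canonical embeddings, the set $\partial_\tau=\{\Lambda\in X^{(2n+1)}:\|\Lambda\|=1,\ \Lambda(\tau)=\|\tau\|\}$ satisfies $$\partial_\tau=\overline{CO}\{f\in\partial_e X^*_1:\tau(f)=\|\tau\|\},$$ where the closure is taken in the weak$^*$-topology of $X^{(2n+1)}=(X^{(2n)})^*$.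
   Context: $X^{(k)}$ denotes the $k$-th dual of $X$ ($X^{(1)}=X^*$, $X^{(2)}=X^{**}$, etc.), and $X\subset X^{(2)}\subset X^{(4)}\subset\cdots$, $X^*\subset X^{(3)}\subset X^{(5)}\subset\cdots$ via the canonical embeddings; elements of $X^*$ are thus regarded as elements of $X^{(2n+1)}$. $E_1$ is the closed unit ball of a Banach space $E$, $\partial_e C$ is the set of extreme points of a convex set $C$, $CO$ denotes convex hull, the bar denotes closure, and $d(\cdot,\cdot)$ is norm distance. A closed subspace $J$ of a Banach space $E$ is an $M$-ideal if there is a linear projection $P:E^*\to E^*$ with $\ker P=J^\perp$ (annihilator) and $\|e^*\|=\|P(e^* )\|+\|e^*-P(e^* )\|$ for all $e^*\in E^*$. *)

theory Defs
  imports "HOL-Analysis.Analysis" "HOL-Probability.Discrete_Topology"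
begin

class complex_banach = banach +
  fixes scaleC :: "complex \<Rightarrow> 'a \<Rightarrow> 'a" (infixr "*\<^sub>C" 75)
  assumes scaleC_add_right: "c *\<^sub>C (x + y) = c *\<^sub>C x + c *\<^sub>C y"
    and scaleC_add_left: "(c + d) *\<^sub>C x = c *\<^sub>C x + d *\<^sub>C x"
    and scaleC_scaleC: "c *\<^sub>C d *\<^sub>C x = (c * d) *\<^sub>C x"
    and scaleR_scaleC: "scaleR r x = complex_of_real r *\<^sub>C x"
    and norm_scaleC: "norm (c *\<^sub>C x) = cmod c * norm x"

definition csubspace :: "'u::complex_banach set \<Rightarrow> bool" where
  "csubspace E \<longleftrightarrow> 0 \<in> E \<and> (\<forall>x\<in>E. \<forall>y\<in>E. x + y \<in> E) \<and> (\<forall>c. \<forall>x\<in>E. c *\<^sub>C x \<in> E)"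

definition clinear_on :: "'u::complex_banach set \<Rightarrow> ('u \<Rightarrow> 'v::complex_banach) \<Rightarrow> bool" where
  "clinear_on E f \<longleftrightarrow>
     (\<forall>x\<in>E. \<forall>y\<in>E. f (x + y) = f x + f y) \<and> (\<forall>c. \<forall>x\<in>E. f (c *\<^sub>C x) = c *\<^sub>C f x)"

instantiation complex :: complex_banach
begin
definition scaleC_complex_def: "c *\<^sub>C (z::complex) = c * z"
instance
  by standard (simp_all add: scaleC_complex_def algebra_simps scaleR_conv_of_real norm_mult)
end

definition bounded_functional_on :: "'u::complex_banach set \<Rightarrow> ('u \<Rightarrow> complex) \<Rightarrow> bool" where
  "bounded_functional_on E \<phi> \<longleftrightarrow>
     clinear_on E \<phi> \<and> (\<exists>B. \<forall>x\<in>E. cmod (\<phi> x) \<le> B * norm x)"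

text \<open>The iterated duals of a space live in infinitely many types, and in general no
  single HOL type holds all of them. We therefore describe finitely many of them at a time, as complex
  subspaces of one ambient Banach space. The predicate \<open>is_dual E E' ev\<close> says that \<open>E'\<close> is
  the normed dual of \<open>E\<close>: \<open>F \<mapsto> ev F\<close> is an isometric complex-linear bijection of \<open>E'\<close> onto the
  space of all bounded complex-linear functionals on \<open>E\<close> with the operator norm. (Injectivity
  follows from the norm identity.) Functionals are compared on \<open>E\<close> only.\<close>

definition is_dual ::
    "'u::complex_banach set \<Rightarrow> 'u set \<Rightarrow> ('u \<Rightarrow> 'u \<Rightarrow> complex) \<Rightarrow> bool" where
  "is_dual E E' ev \<longleftrightarrow>
     csubspace E' \<and>
     (\<forall>F\<in>E'. bounded_functional_on E (ev F)) \<and>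
     (\<forall>\<phi>. bounded_functional_on E \<phi> \<longrightarrow> (\<exists>F\<in>E'. \<forall>x\<in>E. ev F x = \<phi> x)) \<and>
     (\<forall>x\<in>E. clinear_on E' (\<lambda>F. ev F x)) \<and>
     (\<forall>F\<in>E'. norm F = (SUP x\<in>{x\<in>E. norm x \<le> 1}. cmod (ev F x)))"

text \<open>\<open>S 0\<close> is a Banach space and \<open>S k\<close>, for \<open>k \<le> m\<close>, is its \<open>k\<close>-th dual; the duality between
  \<open>S (Suc k)\<close> and \<open>S k\<close> is \<open>ev k\<close>.\<close>

definition dual_tower ::
    "(nat \<Rightarrow> 'u::complex_banach set) \<Rightarrow> (nat \<Rightarrow> 'u \<Rightarrow> 'u \<Rightarrow> complex) \<Rightarrow> nat \<Rightarrow> bool" where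
  "dual_tower S ev m \<longleftrightarrow>
     csubspace (S 0) \<and> closed (S 0) \<and> (\<forall>k<m. is_dual (S k) (S (Suc k)) (ev k))"

text \<open>Such towers exist over every Banach space and with any number of levels: \<open>S 0 = UNIV\<close> is a
  tower with \<open>m = 0\<close>, and a tower with \<open>m\<close> levels extends, after an isometric embedding of the
  ambient space into a larger one, to a tower with \<open>m + 1\<close> levels. A functional on \<open>S m\<close> is
  represented by its restriction to the unit ball, a bounded function.\<close>

instantiation prod :: (complex_banach, complex_banach) complex_banach
begin
definition scaleC_prod_def: "c *\<^sub>C p = (c *\<^sub>C fst p, c *\<^sub>C snd p)"
instance
proof
  fix c :: complex and p :: "'a \<times> 'b"
  have "(norm (c *\<^sub>C p))\<^sup>2 = (cmod c * norm p)\<^sup>2"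
    by (simp add: scaleC_prod_def norm_prod_def norm_scaleC power_mult_distrib distrib_left)
  then show "norm (c *\<^sub>C p) = cmod c * norm p"
    by simp
qed (auto simp: scaleC_prod_def prod_eq_iff scaleC_add_right scaleC_add_left scaleC_scaleC
  scaleR_scaleC)
end

lemma scaleC_one: "1 *\<^sub>C x = (x :: 'a::complex_banach)"
  using scaleR_scaleC[of 1 x] by simp

lemma scaleC_zero: "c *\<^sub>C 0 = (0 :: 'a::complex_banach)"
  using norm_scaleC[of c "0 :: 'a"] by simp

lemma bounded_linear_scaleC: "bounded_linear (\<lambda>x. c *\<^sub>C x)"
  by (rule bounded_linear_intro[where K = "cmod c"])
    (simp_all add: scaleC_add_right scaleR_scaleC scaleC_scaleC mult.commute norm_scaleC)

instantiation bcontfun :: (metric_space, complex_banach) complex_banach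
begin
definition scaleC_bcontfun :: "complex \<Rightarrow> ('a \<Rightarrow>\<^sub>C 'b) \<Rightarrow> 'a \<Rightarrow>\<^sub>C 'b" where
  "scaleC_bcontfun c g = Bcontfun (\<lambda>x. c *\<^sub>C apply_bcontfun g x)"

lemma apply_scaleC_bcontfun [simp]:
  "apply_bcontfun (c *\<^sub>C g) x = c *\<^sub>C apply_bcontfun g x"
proof -
  have "continuous_on UNIV (\<lambda>x. c *\<^sub>C apply_bcontfun g x)"
    by (auto intro: bounded_linear.continuous_on[OF bounded_linear_scaleC])
  moreover have "bounded (range (\<lambda>x. c *\<^sub>C apply_bcontfun g x))"
    using bounded_linear_image[OF bounded_apply_bcontfun bounded_linear_scaleC]
    by (simp add: image_image)
  ultimately show ?thesis
    by (simp add: scaleC_bcontfun_def Bcontfun_inverse bcontfun_def)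
qed

instance
proof
  fix c d :: complex and f g :: "'a \<Rightarrow>\<^sub>C 'b" and r :: real
  show "c *\<^sub>C (f + g) = c *\<^sub>C f + c *\<^sub>C g"
    by (rule bcontfun_eqI) (simp add: scaleC_add_right)
  show "(c + d) *\<^sub>C f = c *\<^sub>C f + d *\<^sub>C f"
    by (rule bcontfun_eqI) (simp add: scaleC_add_left)
  show "c *\<^sub>C d *\<^sub>C f = (c * d) *\<^sub>C f"
    by (rule bcontfun_eqI) (simp add: scaleC_scaleC)
  show "r *\<^sub>R f = complex_of_real r *\<^sub>C f"
    by (rule bcontfun_eqI) (simp add: scaleR_scaleC)
  have le: "norm (c *\<^sub>C f) \<le> cmod c * norm f" for c and f :: "'a \<Rightarrow>\<^sub>C 'b"
    by (rule norm_bound)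
      (simp add: norm_scaleC mult_left_mono norm_bounded)
  show "norm (c *\<^sub>C f) = cmod c * norm f"
  proof (cases "c = 0")
    case True
    then show ?thesis using le[of 0 f] by simp
  next
    case False
    have "inverse c *\<^sub>C c *\<^sub>C f = f"
      using False by (intro bcontfun_eqI)
        (simp add: scaleC_scaleC scaleC_one)
    then have "norm f \<le> norm (c *\<^sub>C f) / cmod c"
      using le[of "inverse c" "c *\<^sub>C f"] by (simp add: norm_inverse divide_inverse mult.commute)
    then show ?thesis
      using False le[of c f] by (simp add: field_simps)
  qed
qed
end

lemma csubspaceD:
  assumes "csubspace E"
  shows "0 \<in> E" "x \<in> E \<Longrightarrow> y \<in> E \<Longrightarrow> x + y \<in> E" "x \<in> E \<Longrightarrow> c *\<^sub>C x \<in> E"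
    "x \<in> E \<Longrightarrow> r *\<^sub>R x \<in> E"
  using assms by (auto simp: csubspace_def scaleR_scaleC)

lemma exists_dual:
  fixes E :: "'u::complex_banach set"
  assumes E: "csubspace E"
  shows "\<exists>(T :: ('u discrete \<Rightarrow>\<^sub>C complex) set) pr. csubspace T \<and>
     (\<forall>g\<in>T. bounded_functional_on E (pr g)) \<and>
     (\<forall>\<phi>. bounded_functional_on E \<phi> \<longrightarrow> (\<exists>g\<in>T. \<forall>x\<in>E. pr g x = \<phi> x)) \<and>
     (\<forall>x\<in>E. clinear_on T (\<lambda>g. pr g x)) \<and>
     (\<forall>g\<in>T. norm g = (SUP x\<in>{x\<in>E. norm x \<le> 1}. cmod (pr g x)))"
proof -
  define B where "B = {x\<in>E. norm x \<le> 1}"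
  define pr :: "('u discrete \<Rightarrow>\<^sub>C complex) \<Rightarrow> 'u \<Rightarrow> complex"
    where "pr g x = complex_of_real (norm x) * apply_bcontfun g (discrete (sgn x))" for g x
  define T where "T = {g. bounded_functional_on E (pr g) \<and>
    (\<forall>x\<in>B. apply_bcontfun g (discrete x) = pr g x) \<and> (\<forall>x. x \<notin> B \<longrightarrow> apply_bcontfun g (discrete x) = 0)}"
  have pr_add: "pr (g + h) x = pr g x + pr h x" for g h x
    by (simp add: pr_def algebra_simps)
  have pr_scale: "pr (c *\<^sub>C g) x = c * pr g x" for c g x
    by (simp add: pr_def scaleC_complex_def)
  have pr_0: "pr 0 x = 0" for x
    by (simp add: pr_def)
  have pr_bound: "cmod (pr g x) \<le> norm g * norm x" for g x
    by (simp add: pr_def norm_mult mult.commute[of "norm g"] mult_left_mono norm_bounded)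
  have bfo: "bounded_functional_on E (pr g) \<longleftrightarrow> clinear_on E (pr g)" for g
    using pr_bound by (auto simp: bounded_functional_on_def)
  have T: "csubspace T"
    by (auto simp: csubspace_def T_def bfo clinear_on_def pr_add pr_scale pr_0
      scaleC_complex_def algebra_simps)
  have lin: "clinear_on T (\<lambda>g. pr g x)" for x
    by (simp add: clinear_on_def pr_add pr_scale scaleC_complex_def)
  have nrm: "norm g = (SUP x\<in>B. cmod (pr g x))" if g: "g \<in> T" for g
  proof (rule antisym)
    have ne: "B \<noteq> {}" using csubspaceD(1)[OF E] by (auto simp: B_def)
    have bd: "cmod (pr g x) \<le> norm g" if "x \<in> B" for x
      using pr_bound[of g x] mult_left_mono[of "norm x" 1 "norm g"] that by (auto simp: B_def)
    then have bdd: "bdd_above ((\<lambda>x. cmod (pr g x)) ` B)"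
      by (auto intro!: bdd_aboveI2)
    have "0 \<le> (SUP x\<in>B. cmod (pr g x))"
      using ne by (metis all_not_in_conv bdd cSUP_upper2 norm_ge_zero)
    then have "cmod (apply_bcontfun g (discrete x)) \<le> (SUP x\<in>B. cmod (pr g x))" for x
      using g by (cases "x \<in> B") (auto simp: T_def intro: cSUP_upper[OF _ bdd])
    then show "norm g \<le> (SUP x\<in>B. cmod (pr g x))"
      by (intro norm_bound) (metis of_discrete_inverse)
    show "(SUP x\<in>B. cmod (pr g x)) \<le> norm g"
      using ne bd by (rule cSUP_least)
  qed
  have ex: "\<exists>g\<in>T. \<forall>x\<in>E. pr g x = \<phi> x" if \<phi>: "bounded_functional_on E \<phi>" for \<phi>
  proof -
    obtain K where K: "\<And>x. x \<in> E \<Longrightarrow> cmod (\<phi> x) \<le> K * norm x"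
      using \<phi> by (auto simp: bounded_functional_on_def)
    define k where "k d = (if of_discrete d \<in> B then \<phi> (of_discrete d) else 0)" for d
    have "cmod (\<phi> x) \<le> \<bar>K\<bar>" if "x \<in> B" for x
    proof -
      have "K * norm x \<le> \<bar>K\<bar> * 1"
        using that by (intro mult_mono) (auto simp: B_def)
      then show ?thesis using K[of x] that by (auto simp: B_def)
    qed
    then have "k \<in> bcontfun"
      by (intro bcontfun_normI[where b = "\<bar>K\<bar>"])
        (auto simp: k_def continuous_on_open_invariant open_discrete)
    then have app: "apply_bcontfun (Bcontfun k) = k"
      by (simp add: Bcontfun_inverse)
    have hom: "\<phi> (r *\<^sub>R x) = complex_of_real r * \<phi> x" if "x \<in> E" for r x
      using \<phi> that by (simp add: bounded_functional_on_def clinear_on_def scaleR_scaleC scaleC_complex_def)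
    have eq: "pr (Bcontfun k) x = \<phi> x" if x: "x \<in> E" for x
    proof -
      have "sgn x \<in> B"
        using csubspaceD(4)[OF E x, of "inverse (norm x)"] norm_sgn[of x]
        by (simp add: B_def flip: sgn_div_norm)
      then have "pr (Bcontfun k) x = complex_of_real (norm x) * \<phi> (sgn x)"
        by (simp add: pr_def app k_def discrete_inverse)
      also have "\<dots> = \<phi> x"
        using hom[OF x, of "inverse (norm x)"] hom[OF x, of 0] by (cases "x = 0") (simp_all add: sgn_div_norm)
      finally show ?thesis .
    qed
    have "clinear_on E (pr (Bcontfun k))"
      using \<phi> E by (simp add: bounded_functional_on_def clinear_on_def eq csubspace_def)
    then have "Bcontfun k \<in> T"
      by (auto simp: T_def bfo eq app k_def B_def discrete_inverse)
    then show ?thesis using eq by blast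
  qed
  show ?thesis
    using T lin nrm ex by (intro exI[of _ T] exI[of _ pr]) (auto simp: T_def B_def)
qed

lemma dual_tower_extend:
  fixes S :: "nat \<Rightarrow> 'u::complex_banach set"
  assumes S: "dual_tower S ev m"
  obtains S' :: "nat \<Rightarrow> ('u \<times> ('u discrete \<Rightarrow>\<^sub>C complex)) set" and ev'
  where "dual_tower S' ev' (Suc m)"
    "\<And>k. k \<le> m \<Longrightarrow> S' k = (\<lambda>x. (x, 0)) ` S k"
    "\<And>k F x. k < m \<Longrightarrow> ev' k (F, 0) (x, 0) = ev k F x"
proof -
  have sub: "csubspace (S k)" if "k \<le> m" for k
    using S that by (cases k) (auto simp: dual_tower_def is_dual_def)
  obtain T :: "('u discrete \<Rightarrow>\<^sub>C complex) set" and pr where T: "csubspace T"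
     "\<And>g. g\<in>T \<Longrightarrow> bounded_functional_on (S m) (pr g)"
     "\<And>\<phi>. bounded_functional_on (S m) \<phi> \<Longrightarrow> (\<exists>g\<in>T. \<forall>x\<in>S m. pr g x = \<phi> x)"
     "\<And>x. x\<in>S m \<Longrightarrow> clinear_on T (\<lambda>g. pr g x)"
     "\<And>g. g\<in>T \<Longrightarrow> norm g = (SUP x\<in>{x\<in>S m. norm x \<le> 1}. cmod (pr g x))"
    using exists_dual[OF sub[of m]] by blast
  define S' :: "nat \<Rightarrow> ('u \<times> ('u discrete \<Rightarrow>\<^sub>C complex)) set"
    where "S' k = (if k \<le> m then (\<lambda>x. (x, 0)) ` S k else Pair 0 ` T)" for k
  define ev' :: "nat \<Rightarrow> 'u \<times> ('u discrete \<Rightarrow>\<^sub>C complex) \<Rightarrow> 'u \<times> ('u discrete \<Rightarrow>\<^sub>C complex) \<Rightarrow> complex"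
    where "ev' k F x = (if k < m then ev k (fst F) (fst x) else pr (snd F) (fst x))" for k F x
  have sub': "csubspace (S' k)" if "k \<le> Suc m" for k
    using that sub[of k] T(1) unfolding csubspace_def S'_def
    by (auto simp: scaleC_prod_def scaleC_zero zero_prod_def)
  have bf: "bounded_functional_on ((\<lambda>x. (x, 0)) ` A) \<phi> \<longleftrightarrow> bounded_functional_on A (\<lambda>x. \<phi> (x, 0))"
    for A :: "'u set" and \<phi> :: "'u \<times> ('u discrete \<Rightarrow>\<^sub>C complex) \<Rightarrow> complex"
    by (simp add: bounded_functional_on_def clinear_on_def scaleC_prod_def scaleC_zero)
  have ball: "{x \<in> (\<lambda>x. (x, 0)) ` A. norm x \<le> 1} = (\<lambda>x. (x, 0::'u discrete \<Rightarrow>\<^sub>C complex)) ` {x\<in>A. norm x \<le> 1}"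
    for A :: "'u set"
    by auto
  have old: "is_dual (S' k) (S' (Suc k)) (ev' k)" if k: "k < m" for k
  proof -
    have d: "is_dual (S k) (S (Suc k)) (ev k)"
      using S k by (simp add: dual_tower_def)
    then show ?thesis
      using k sub'[of "Suc k"] unfolding is_dual_def S'_def ev'_def
      by (simp add: bf ball image_image)
        (simp add: clinear_on_def scaleC_prod_def scaleC_zero)
  qed
  have new: "is_dual (S' m) (S' (Suc m)) (ev' m)"
    using sub'[of "Suc m"] T unfolding is_dual_def S'_def ev'_def
    by (simp add: bf ball image_image)
      (simp add: clinear_on_def scaleC_prod_def scaleC_zero)
  have "closed (S' 0)"
  proof -
    have "S' 0 = S 0 \<times> {0}" by (auto simp: S'_def)
    then show ?thesis using S by (simp add: dual_tower_def closed_Times)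
  qed
  then have "dual_tower S' ev' (Suc m)"
    using sub'[of 0] old new by (auto simp: dual_tower_def less_Suc_eq)
  then show thesis
    by (rule that) (auto simp: S'_def ev'_def)
qed

definition canon ::
    "(nat \<Rightarrow> 'u::complex_banach set) \<Rightarrow> (nat \<Rightarrow> 'u \<Rightarrow> 'u \<Rightarrow> complex) \<Rightarrow> nat \<Rightarrow> 'u \<Rightarrow> 'u" where
  "canon S ev k x =
     (THE y. y \<in> S (k + 2) \<and> (\<forall>f\<in>S (k + 1). ev (k + 1) y f = ev k f x))"

text \<open>The composite \<open>S k \<rightarrow> S (k + 2) \<rightarrow> \<dots> \<rightarrow> S (k + 2 * j)\<close> of canonical embeddings.\<close>

primrec canon_iter ::
    "(nat \<Rightarrow> 'u::complex_banach set) \<Rightarrow> (nat \<Rightarrow> 'u \<Rightarrow> 'u \<Rightarrow> complex) \<Rightarrow> nat \<Rightarrow> nat \<Rightarrow> 'u \<Rightarrow> 'u" where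
  "canon_iter S ev k 0 x = x"
| "canon_iter S ev k (Suc j) x = canon S ev (k + 2 * j) (canon_iter S ev k j x)"

definition annihilator ::
    "'u::complex_banach set \<Rightarrow> ('u \<Rightarrow> 'u \<Rightarrow> complex) \<Rightarrow> 'u set \<Rightarrow> 'u set" where
  "annihilator E' ev J = {F\<in>E'. \<forall>x\<in>J. ev F x = 0}"

definition M_ideal ::
    "'u::complex_banach set \<Rightarrow> 'u set \<Rightarrow> 'u set \<Rightarrow> ('u \<Rightarrow> 'u \<Rightarrow> complex) \<Rightarrow> bool" where
  "M_ideal J E E' ev \<longleftrightarrow>
     csubspace J \<and> closed J \<and> J \<subseteq> E \<and>
     (\<exists>P. P ` E' \<subseteq> E' \<and> clinear_on E' P \<and> (\<forall>F\<in>E'. P (P F) = P F) \<and>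
          {F\<in>E'. P F = 0} = annihilator E' ev J \<and>
          (\<forall>F\<in>E'. norm F = norm (P F) + norm (F - P F)))"

definition weak_star ::
    "'u::complex_banach set \<Rightarrow> 'u set \<Rightarrow> ('u \<Rightarrow> 'u \<Rightarrow> complex) \<Rightarrow> 'u topology" where
  "weak_star E E' ev =
     topology_generated_by {{F\<in>E'. ev F x \<in> U} | x U. x \<in> E \<and> open U}"

end

theory Submission
  imports Defs
begin

text \<open>The \<open>M\<close>-ideal property makes the restriction \<open>\<Lambda> \<mapsto> \<Lambda>|X\<close> an \<open>L\<close>-projection of \<open>X\<^sup>*\<^sup>*\<^sup>*\<close> onto
  \<open>X\<^sup>*\<close>, and this passes to every higher odd dual: \<open>\<parallel>\<Lambda>\<parallel> = \<parallel>f\<parallel> + \<parallel>\<Lambda> - f\<parallel>\<close> with \<open>f = \<Lambda>|X\<close>. The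
  functional \<open>\<Lambda> - f\<close> annihilates \<open>X\<close>, so its value at \<open>\<tau>\<close> is at most \<open>\<parallel>\<Lambda> - f\<parallel> d(\<tau>, X)\<close>. If \<open>\<Lambda>\<close> has norm
  one and norms \<open>\<tau>\<close>, then \<open>d(\<tau>, X) < \<parallel>\<tau>\<parallel>\<close> forces \<open>\<Lambda> = f \<in> X\<^sup>*\<close>. Thus the norming functionals of \<open>\<tau>\<close>
  form a weak*-compact convex set whose extreme points come from extreme points of the unit ball of \<open>X\<^sup>*\<close>,
  and the Krein--Milman theorem applies. The Hahn--Banach theorem is not needed: norming functionals
  exist by weak*-compactness, and compact convex sets are separated from points by minimising a
  finite sum of squares.\<close>

subsection \<open>The Krein--Milman theorem\<close>

text \<open>Such functions take the role of continuous linear functionals. Affinity is demanded on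
  the carrier only, because \<open>T\<close> lives on the compact convex set itself and not on a
  surrounding vector space.\<close>

definition affine_continuous :: "'a::real_vector topology \<Rightarrow> ('a \<Rightarrow> real) \<Rightarrow> bool" where
  "affine_continuous T h \<longleftrightarrow> continuous_map T euclideanreal h \<and>
     (\<forall>a\<in>topspace T. \<forall>b\<in>topspace T. \<forall>t\<in>{0..1}.
        h ((1 - t) *\<^sub>R a + t *\<^sub>R b) = (1 - t) * h a + t * h b)"

text \<open>A compact convex set without its ambient space: a supply of continuous affine functions
  that separates points stands in for local convexity, and mixing with a fixed point for continuity
  of the vector operations.\<close>

locale compact_convex =
  fixes T :: "'a::real_vector topology"
  assumes compact: "compact_space T"
    and convex: "convex (topspace T)"
    and separating: "a \<in> topspace T \<Longrightarrow> b \<in> topspace T \<Longrightarrow> a \<noteq> b \<Longrightarrow>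
      \<exists>h. affine_continuous T h \<and> h a \<noteq> h b"
    and continuous_mix: "b \<in> topspace T \<Longrightarrow> t \<in> {0..1} \<Longrightarrow>
      continuous_map T T (\<lambda>a. (1 - t) *\<^sub>R a + t *\<^sub>R b)"
begin

lemma attains_max:
  assumes F: "closedin T F" "F \<noteq> {}" and h: "continuous_map T euclideanreal h"
  obtains x where "x \<in> F" "\<And>y. y \<in> F \<Longrightarrow> h y \<le> h x"
proof -
  have "compactin T F"
    using closedin_compact_space[OF compact F(1)] .
  then have "compact (h ` F)"
    using image_compactin[OF _ h] by auto
  then show thesis
    using compact_attains_sup[of "h ` F"] F(2) that by blast
qed

text \<open>If an affine function is below its maximum at an end point of a segment, it is so at
  every inner point. Hence the maximisers form a face of \<open>F\<close>, and a face of a face is a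
  face.\<close>

lemma closed_face_argmax:
  assumes F: "closedin T F" "F \<noteq> {}" "F face_of topspace T" and h: "affine_continuous T h"
  defines "G \<equiv> {x \<in> F. \<forall>y\<in>F. h y \<le> h x}"
  shows "closedin T G" "G \<noteq> {}" "G face_of topspace T"
proof -
  have hc: "continuous_map T euclideanreal h"
    and ha: "\<And>a b t. a \<in> topspace T \<Longrightarrow> b \<in> topspace T \<Longrightarrow> 0 \<le> t \<Longrightarrow> t \<le> 1 \<Longrightarrow>
        h ((1 - t) *\<^sub>R a + t *\<^sub>R b) = (1 - t) * h a + t * h b"
    using h by (auto simp: affine_continuous_def)
  obtain z where z: "z \<in> F" "\<And>y. y \<in> F \<Longrightarrow> h y \<le> h z"
    using attains_max[OF F(1,2) hc] by blast
  have FT: "F \<subseteq> topspace T"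
    using F(1) closedin_subset by blast
  have G: "G = F \<inter> {x \<in> topspace T. h x \<in> {h z..}}"
    using z FT by (auto simp: G_def intro: order_trans)
  show "closedin T G"
    unfolding G by (intro closedin_Int F closedin_continuous_map_preimage[OF hc]) auto
  show "G \<noteq> {}"
    using z by (auto simp: G_def)
  have Gz: "x \<in> G \<longleftrightarrow> x \<in> F \<and> h x = h z" for x
    using z by (force simp: G_def)
  have "convex F"
    using F(3) face_of_imp_convex by blast
  then have "convex G"
    using FT by (auto simp: convex_alt Gz ha subset_iff simp del: scaleR_left_diff_distrib scaleR_right_diff_distrib)
      (simp add: algebra_simps)
  moreover have "a \<in> G \<and> b \<in> G" if ab: "a \<in> F" "b \<in> F" and x: "x \<in> G" "x \<in> open_segment a b" for a b x
  proof -
    obtain t where t: "0 < t" "t < 1" "x = (1 - t) *\<^sub>R a + t *\<^sub>R b"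
      using x(2) by (auto simp: in_segment)
    have e: "(1 - t) * (h z - h a) + t * (h z - h b) = 0"
    proof -
      have "h x = (1 - t) * h a + t * h b"
        unfolding t(3) using ab FT t by (intro ha) auto
      then show ?thesis using x(1) by (simp add: Gz algebra_simps)
    qed
    have "0 \<le> (1 - t) * (h z - h a)" "0 \<le> t * (h z - h b)"
      using t z(2) ab by auto
    then have "(1 - t) * (h z - h a) = 0" "t * (h z - h b) = 0"
      using e by linarith+
    then show ?thesis using t ab by (auto simp: Gz)
  qed
  ultimately have "G face_of F"
    unfolding face_of_def using Gz by blast
  then show "G face_of topspace T"
    using F(3) face_of_trans by blast
qed

text \<open>Zorn's lemma gives a minimal closed nonempty face inside \<open>F\<close>. If it had two
  points, the maximisers of a function separating them would form a smaller one. A singleton face is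
  an extreme point.\<close>

lemma extreme_point_in_face:
  assumes F: "closedin T F" "F \<noteq> {}" "F face_of topspace T"
  shows "\<exists>p\<in>F. p extreme_point_of topspace T"
proof -
  define \<F> where "\<F> = {G. closedin T G \<and> G \<noteq> {} \<and> G face_of topspace T \<and> G \<subseteq> F}"
  have chain: "\<exists>L\<in>\<F>. \<forall>G\<in>\<C>. L \<subseteq> G" if C: "\<C> \<subseteq> \<F>" "\<And>A B. A \<in> \<C> \<Longrightarrow> B \<in> \<C> \<Longrightarrow> A \<subseteq> B \<or> B \<subseteq> A" for \<C>
  proof (cases "\<C> = {}")
    case True
    then show ?thesis using F by (auto simp: \<F>_def)
  next
    case False
    \<comment> \<open>Finite intersections of members of a chain are members again, hence nonempty:
      the finite intersection property for compactness.\<close>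
    have fin: "\<Inter>\<D> \<in> \<C>" if "finite \<D>" "\<D> \<noteq> {}" "\<D> \<subseteq> \<C>" for \<D>
      using that
    proof (induction rule: finite_ne_induct)
      case (insert A \<D>)
      then have "A \<subseteq> \<Inter>\<D> \<or> \<Inter>\<D> \<subseteq> A" using C(2) by blast
      then have "\<Inter>(insert A \<D>) = A \<or> \<Inter>(insert A \<D>) = \<Inter>\<D>" by auto
      then show ?case using insert by auto
    qed auto
    have "\<Inter>\<C> \<noteq> {}"
    proof -
      have "\<Inter>\<D> \<noteq> {}" if "finite \<D>" "\<D> \<subseteq> \<C>" for \<D>
        using fin[of \<D>] that C(1) by (cases "\<D> = {}") (auto simp: \<F>_def)
      moreover have "\<forall>G\<in>\<C>. closedin T G"
        using C(1) by (auto simp: \<F>_def)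
      ultimately show ?thesis
        using compact[unfolded compact_space_fip, rule_format, of \<C>] by auto
    qed
    moreover have "closedin T (\<Inter>\<C>)"
      using C(1) False by (intro closedin_Inter) (auto simp: \<F>_def)
    moreover have "\<Inter>\<C> face_of topspace T"
      using C(1) False by (intro face_of_Inter) (auto simp: \<F>_def)
    moreover have "\<Inter>\<C> \<subseteq> F"
      using C(1) False by (auto simp: \<F>_def)
    ultimately show ?thesis
      by (auto simp: \<F>_def)
  qed
  have "\<exists>M\<in>\<F>. \<forall>A\<in>\<F>. A \<subseteq> M \<longrightarrow> A = M"
    by (intro predicate_Zorn[where P = "\<lambda>A B. B \<subseteq> A"])
      (auto simp: Chains_def relation_of_def partial_order_on_def preorder_on_def refl_on_def
        trans_def antisym_def intro!: chain)
  then obtain M where M: "M \<in> \<F>" and min: "\<And>A. A \<in> \<F> \<Longrightarrow> A \<subseteq> M \<Longrightarrow> A = M"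
    by blast
  then obtain p where p: "p \<in> M" by (auto simp: \<F>_def)
  have "q = p" if q: "q \<in> M" for q
  proof (rule ccontr)
    assume "q \<noteq> p"
    moreover have MT: "M \<subseteq> topspace T"
      using M by (auto simp: \<F>_def dest: closedin_subset)
    ultimately obtain h where h: "affine_continuous T h" "h q \<noteq> h p"
      using separating[of q p] p q by auto
    define G where "G = {x \<in> M. \<forall>y\<in>M. h y \<le> h x}"
    have "closedin T G" "G \<noteq> {}" "G face_of topspace T"
      using closed_face_argmax[OF _ _ _ h(1), of M] M by (auto simp: G_def \<F>_def)
    moreover have "G \<subseteq> M" by (auto simp: G_def)
    ultimately have "G = M"
      using M by (intro min) (auto simp: \<F>_def)
    then have "q \<in> G" "p \<in> G" using p q by auto
    then show False
      using h(2) by (force simp: G_def)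
  qed
  then have "M = {p}" using p by blast
  then show ?thesis
    using M by (auto simp: \<F>_def face_of_singleton)
qed

text \<open>Mixing is continuous in one argument at a time, so there are two rounds:
  \<open>one\<close> mixes a limit point with a point of \<open>A\<close>; then the limit point
  \<open>x\<close> is fixed and the other argument passes from \<open>A\<close> to its
  closure.\<close>

lemma convex_closure_of:
  assumes A: "convex A" "A \<subseteq> topspace T"
  shows "convex (T closure_of A)"
proof -
  have one: "(1 - t) *\<^sub>R x + t *\<^sub>R b \<in> T closure_of A"
    if x: "x \<in> T closure_of A" and b: "b \<in> A" and t: "t \<in> {0..1}" for x b t
  proof -
    let ?m = "\<lambda>a. (1 - t) *\<^sub>R a + t *\<^sub>R b"
    have "?m ` A \<subseteq> A"
      using A(1) b t by (auto simp: convex_alt)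
    moreover have "?m ` (T closure_of A) \<subseteq> T closure_of (?m ` A)"
      using continuous_mix[of b t] A(2) b t by (intro continuous_map_image_closure_subset) auto
    ultimately show ?thesis
      using x closure_of_mono by blast
  qed
  have "(1 - t) *\<^sub>R x + t *\<^sub>R y \<in> T closure_of A"
    if x: "x \<in> T closure_of A" and y: "y \<in> T closure_of A" and t: "t \<in> {0..1}" for x y t
  proof -
    let ?m = "\<lambda>a. (1 - (1 - t)) *\<^sub>R a + (1 - t) *\<^sub>R x"
    have "x \<in> topspace T"
      using x closure_of_subset_topspace[of T A] by blast
    then have "?m ` (T closure_of A) \<subseteq> T closure_of (?m ` A)"
      using continuous_mix[of x "1 - t"] t by (intro continuous_map_image_closure_subset) auto
    moreover have "?m ` A \<subseteq> T closure_of A"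
      using one[OF x _ t] by (auto simp: add.commute)
    then have "T closure_of (?m ` A) \<subseteq> T closure_of A"
      by (simp add: closure_of_minimal)
    ultimately have "?m y \<in> T closure_of A"
      using y by (meson image_subset_iff subsetD)
    then show ?thesis
      by (simp add: add.commute)
  qed
  then show ?thesis
    by (auto simp: convex_alt)
qed

text \<open>By compactness, finitely many affine functions distinguish \<open>p\<close> from all
  points of \<open>C\<close>. They map \<open>C\<close> to a convex set in a finite-dimensional
  space that misses the image of \<open>p\<close>, and the nearest point of that set yields the
  separating function.\<close>

lemma separate_closed_convex_point:
  assumes C: "closedin T C" "convex C" "C \<noteq> {}" and p: "p \<in> topspace T" "p \<notin> C"
  obtains g where "affine_continuous T g" "\<And>c. c \<in> C \<Longrightarrow> g c < g p"
proof -
  define V where "V h = {x \<in> topspace T. h x \<noteq> h p}" for h :: "'a \<Rightarrow> real"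
  have CT: "C \<subseteq> topspace T" using C(1) by (rule closedin_subset)
  have Cc: "compactin T C"
    using closedin_compact_space[OF compact C(1)] .
  let ?U = "V ` Collect (affine_continuous T)"
  have "openin T U" if U: "U \<in> ?U" for U
  proof -
    obtain h where h: "affine_continuous T h" "U = V h"
      using U by auto
    have "openin T {x \<in> topspace T. h x \<in> - {h p}}"
      using h(1) by (intro openin_continuous_map_preimage[where Y = euclideanreal])
        (auto simp: affine_continuous_def)
    then show ?thesis by (simp add: h(2) V_def)
  qed
  moreover have "C \<subseteq> \<Union>?U"
  proof
    fix c assume "c \<in> C"
    then show "c \<in> \<Union>?U"
      using separating[of c p] p CT by (auto simp: V_def)
  qed
  ultimately obtain \<U> where \<U>: "finite \<U>" "\<U> \<subseteq> ?U" "C \<subseteq> \<Union>\<U>"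
    using compactinD[OF Cc] by meson
  then obtain I where I: "finite I" "I \<subseteq> Collect (affine_continuous T)" "\<U> = V ` I"
    by (meson finite_subset_image)
  have hc: "continuous_map T euclideanreal h" if "h \<in> I" for h
    using I that by (auto simp: affine_continuous_def)
  have ha: "h ((1 - t) *\<^sub>R a + t *\<^sub>R b) = (1 - t) * h a + t * h b"
    if "h \<in> I" "a \<in> topspace T" "b \<in> topspace T" "t \<in> {0..1}" for h a b t
    using I that by (auto simp: affine_continuous_def)
  define q where "q x = (\<Sum>h\<in>I. (h x - h p)\<^sup>2)" for x
  have qc: "continuous_map T euclideanreal (\<lambda>x. - q x)"
    unfolding q_def using I(1) hc
    by (intro continuous_intros continuous_map_sum continuous_map_real_pow continuous_map_diff) auto
  obtain c0 where c0: "c0 \<in> C" "\<And>c. c \<in> C \<Longrightarrow> q c0 \<le> q c"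
    using attains_max[OF C(1,3) qc] by auto
  have q0: "0 < q c0"
  proof -
    obtain h where h: "h \<in> I" "h c0 \<noteq> h p"
      using c0(1) \<U>(3) I(3) by (auto simp: V_def)
    then have "0 < (h c0 - h p)\<^sup>2" by simp
    also have "\<dots> \<le> q c0"
      unfolding q_def using I(1) h(1) by (intro member_le_sum) auto
    finally show ?thesis .
  qed
  \<comment> \<open>\<open>g\<close> is, up to a factor, minus the derivative of \<open>q\<close> at its minimiser \<open>c0\<close>.\<close>
  define g where "g x = (\<Sum>h\<in>I. (h p - h c0) * h x)" for x
  have "continuous_map T euclideanreal g"
    unfolding g_def using I(1) hc
    by (intro continuous_map_sum continuous_map_real_mult) auto
  moreover have "g ((1 - t) *\<^sub>R a + t *\<^sub>R b) = (1 - t) * g a + t * g b"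
    if "a \<in> topspace T" "b \<in> topspace T" "t \<in> {0..1}" for a b t
  proof -
    have "g ((1 - t) *\<^sub>R a + t *\<^sub>R b) = (\<Sum>h\<in>I. (h p - h c0) * ((1 - t) * h a + t * h b))"
      unfolding g_def using that by (intro sum.cong refl) (simp add: ha)
    then show ?thesis
      by (simp add: g_def sum_distrib_left algebra_simps flip: sum.distrib)
  qed
  ultimately have g: "affine_continuous T g"
    by (simp add: affine_continuous_def)
  have "g c < g p" if c: "c \<in> C" for c
  proof -
    define u where "u h = h c0 - h p" for h :: "'a \<Rightarrow> real"
    define v where "v h = h c - h c0" for h :: "'a \<Rightarrow> real"
    define B where "B = (\<Sum>h\<in>I. (v h)\<^sup>2)"
    define A where "A = (\<Sum>h\<in>I. u h * v h)"
    \<comment> \<open>Minimality of \<open>q\<close> at \<open>c0\<close> along the segment towards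
      \<open>c\<close>, divided by \<open>t\<close>; \<open>2 * A\<close> is the derivative at
      \<open>c0\<close> in that direction.\<close>
    have quad: "0 \<le> 2 * A + t * B" if t: "0 < t" "t \<le> 1" for t
    proof -
      have "(1 - t) *\<^sub>R c0 + t *\<^sub>R c \<in> C"
        using C(2) c0(1) c t by (auto simp: convex_alt)
      then have "q c0 \<le> q ((1 - t) *\<^sub>R c0 + t *\<^sub>R c)"
        by (rule c0(2))
      also have "\<dots> = (\<Sum>h\<in>I. (u h + t * v h)\<^sup>2)"
        unfolding q_def
      proof (intro sum.cong refl)
        fix h assume "h \<in> I"
        then have "h ((1 - t) *\<^sub>R c0 + t *\<^sub>R c) = (1 - t) * h c0 + t * h c"
          using CT c0(1) c t by (intro ha) auto
        then show "(h ((1 - t) *\<^sub>R c0 + t *\<^sub>R c) - h p)\<^sup>2 = (u h + t * v h)\<^sup>2"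
          unfolding u_def v_def by (simp only:) (simp add: algebra_simps)
      qed
      also have "\<dots> = q c0 + t * (2 * A + t * B)"
        by (simp add: q_def A_def B_def u_def[symmetric] power2_eq_square sum_distrib_left
            algebra_simps flip: sum.distrib)
      finally show ?thesis
        using t(1) by (simp add: zero_le_mult_iff)
    qed
    have "0 \<le> A"
    proof (rule ccontr)
      assume "\<not> 0 \<le> A"
      then have A: "A < 0" by simp
      have B: "0 \<le> B" by (simp add: B_def sum_nonneg)
      \<comment> \<open>Chosen so that \<open>t * B \<le> - A\<close>, hence
        \<open>2 * A + t * B \<le> A < 0\<close>; the \<open>+ 1\<close> keeps the denominator
        positive when \<open>B = 0\<close>.\<close>
      define t where "t = min 1 (- A / (B + 1))"
      have t: "0 < t" "t \<le> 1" using A B by (auto simp: t_def divide_simps)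
      have "t * B \<le> (- A / (B + 1)) * B"
        using B by (intro mult_right_mono) (auto simp: t_def)
      also have "\<dots> \<le> - A" using A B by (simp add: divide_simps)
      finally show False using quad[OF t] A by simp
    qed
    moreover have "g p - g c = q c0 + A"
      by (simp add: g_def q_def A_def u_def v_def power2_eq_square algebra_simps
          flip: sum.distrib sum_subtractf)
    ultimately show ?thesis using q0 by linarith
  qed
  then show thesis using g that by blast
qed

text \<open>A point \<open>p\<close> outside the closed hull would be strictly separated from it by
  some \<open>g\<close>. The face where \<open>g\<close> is maximal contains an extreme point, at
  which \<open>g\<close> would be both below \<open>g p\<close> and at least
  \<open>g p\<close>.\<close>

lemma Krein_Milman:
  "T closure_of (convex hull {p. p extreme_point_of topspace T}) = topspace T"
proof (rule ccontr)
  let ?A = "convex hull {p. p extreme_point_of topspace T}"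
  let ?C = "T closure_of ?A"
  assume "?C \<noteq> topspace T"
  then obtain p where p: "p \<in> topspace T" "p \<notin> ?C"
    using closure_of_subset_topspace[of T ?A] by blast
  have sub: "?A \<subseteq> topspace T"
    using convex by (intro hull_minimal) (auto simp: extreme_point_of_def)
  have self: "topspace T face_of topspace T"
    using convex by (simp add: face_of_refl)
  have ext: "e \<in> ?C" if "e extreme_point_of topspace T" for e
    using closure_of_subset[OF sub] that hull_subset[of "{p. p extreme_point_of topspace T}" convex]
    by auto
  have ne: "topspace T \<noteq> {}" using p by auto
  \<comment> \<open>Separation asks for a nonempty set; the whole carrier is a face of itself and so
    contains an extreme point.\<close>
  then have "?C \<noteq> {}"
    using extreme_point_in_face[OF closedin_topspace _ self] ext by auto
  then obtain g where g: "affine_continuous T g" "\<And>c. c \<in> ?C \<Longrightarrow> g c < g p"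
    using separate_closed_convex_point[OF closedin_closure_of convex_closure_of _ p] sub by blast
  obtain e where e: "e \<in> {x \<in> topspace T. \<forall>y\<in>topspace T. g y \<le> g x}" "e extreme_point_of topspace T"
    using extreme_point_in_face[OF closed_face_argmax[OF closedin_topspace ne self g(1)]] by blast
  then show False
    using g(2)[OF ext[OF e(2)]] p(1) by auto
qed

end

subsection \<open>Dual pairs\<close>

lemma csubspace_diff:
  assumes "csubspace E" "x \<in> E" "y \<in> E"
  shows "x - y \<in> E"
  using csubspaceD(2)[OF assms(1,2) csubspaceD(4)[OF assms(1,3), of "-1"]] by simp

lemma clinear_onD:
  assumes "clinear_on E f"
  shows "x \<in> E \<Longrightarrow> y \<in> E \<Longrightarrow> f (x + y) = f x + f y"
    and "x \<in> E \<Longrightarrow> f (c *\<^sub>C x) = c *\<^sub>C f x"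
    and "x \<in> E \<Longrightarrow> f (r *\<^sub>R x) = r *\<^sub>R f x"
  using assms by (auto simp: clinear_on_def scaleR_scaleC)

lemma clinear_on_diff:
  assumes "clinear_on E f" "csubspace E" "x \<in> E" "y \<in> E"
  shows "f (x - y) = f x - f y"
  using clinear_onD(1)[OF assms(1,3) csubspaceD(4)[OF assms(2,4), of "-1"]]
    clinear_onD(3)[OF assms(1,4), of "-1"] by simp

lemma phase_exists:
  fixes z :: complex
  obtains c where "cmod c \<le> 1" "c * z = complex_of_real (cmod z)"
proof (cases "z = 0")
  case True
  then show ?thesis using that[of 0] by simp
next
  case False
  then have "cnj z / cmod z * z = complex_of_real (cmod z)"
    by (simp add: field_simps power2_eq_square flip: complex_norm_square)
  then show ?thesis using that[of "cnj z / cmod z"] False by (simp add: norm_divide)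
qed

definition contraction_on ::
    "'u::complex_banach set \<Rightarrow> 'v::complex_banach set \<Rightarrow> ('u \<Rightarrow> 'v) \<Rightarrow> bool" where
  "contraction_on D E T \<longleftrightarrow> clinear_on D T \<and> (\<forall>x\<in>D. T x \<in> E \<and> norm (T x) \<le> norm x)"

lemma contraction_onD:
  assumes "contraction_on D E T"
  shows "clinear_on D T" "x \<in> D \<Longrightarrow> T x \<in> E" "x \<in> D \<Longrightarrow> norm (T x) \<le> norm x"
  using assms by (auto simp: contraction_on_def)

lemma contraction_on_id: "contraction_on D D (\<lambda>x. x)"
  by (simp add: contraction_on_def clinear_on_def)

lemma contraction_on_compose:
  assumes "contraction_on D E T" "contraction_on E F U"
  shows "contraction_on D F (\<lambda>x. U (T x))"
  using assms unfolding contraction_on_def clinear_on_def by (auto; meson order_trans)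

locale dual_pair =
  fixes E E' :: "'u::complex_banach set" and ev :: "'u \<Rightarrow> 'u \<Rightarrow> complex"
  assumes csubspace: "csubspace E" and is_dual: "is_dual E E' ev"
begin

lemma csubspace_dual: "csubspace E'"
  using is_dual by (simp add: is_dual_def)

lemma clinear_functional: "F \<in> E' \<Longrightarrow> clinear_on E (ev F)"
  using is_dual by (auto simp: is_dual_def bounded_functional_on_def)

lemma clinear_evaluation: "x \<in> E \<Longrightarrow> clinear_on E' (\<lambda>F. ev F x)"
  using is_dual by (auto simp: is_dual_def)

lemma norm_le:
  assumes "F \<in> E'" "\<And>x. x \<in> E \<Longrightarrow> norm x \<le> 1 \<Longrightarrow> cmod (ev F x) \<le> B"
  shows "norm F \<le> B"
proof -
  have "norm F = (SUP x\<in>{x\<in>E. norm x \<le> 1}. cmod (ev F x))"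
    using assms(1) is_dual by (simp add: is_dual_def)
  also have "\<dots> \<le> B"
    using assms(2) csubspaceD(1)[OF csubspace] by (intro cSUP_least) auto
  finally show ?thesis .
qed

text \<open>Multiplying \<open>x\<close> by a suitable phase keeps it in the unit ball and turns
  \<open>ev F x\<close> into its modulus.\<close>

lemma norm_le_Re:
  assumes F: "F \<in> E'" and B: "\<And>x. x \<in> E \<Longrightarrow> norm x \<le> 1 \<Longrightarrow> Re (ev F x) \<le> B"
  shows "norm F \<le> B"
proof (rule norm_le[OF F])
  fix x assume x: "x \<in> E" "norm x \<le> 1"
  obtain c where c: "cmod c \<le> 1" "c * ev F x = complex_of_real (cmod (ev F x))"
    by (rule phase_exists)
  have "Re (ev F (c *\<^sub>C x)) \<le> B"
    using x c(1) csubspaceD(3)[OF csubspace x(1)] mult_mono[OF c(1) x(2)]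
    by (intro B) (auto simp: norm_scaleC)
  then show "cmod (ev F x) \<le> B"
    using c(2) clinear_onD(2)[OF clinear_functional[OF F] x(1)]
    by (simp add: scaleC_complex_def)
qed

lemma ev_bound:
  assumes F: "F \<in> E'" and x: "x \<in> E"
  shows "cmod (ev F x) \<le> norm F * norm x"
proof -
  have hom: "ev F (r *\<^sub>R x) = r *\<^sub>R ev F x" for r
    using clinear_onD(3)[OF clinear_functional[OF F] x] .
  obtain B where B: "\<And>y. y \<in> E \<Longrightarrow> cmod (ev F y) \<le> B * norm y"
    using F is_dual unfolding is_dual_def bounded_functional_on_def by blast
  show ?thesis
  proof (cases "x = 0")
    case True
    then show ?thesis using hom[of 0] by simp
  next
    case False
    let ?y = "inverse (norm x) *\<^sub>R x"
    \<comment> \<open>A real supremum dominates its terms only over a set that is bounded above;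
      boundedness of the functional with some constant \<open>B\<close> provides this.\<close>
    have "bdd_above ((\<lambda>y. cmod (ev F y)) ` {y\<in>E. norm y \<le> 1})"
    proof (rule bdd_aboveI2[where M = "\<bar>B\<bar>"])
      fix y assume y: "y \<in> {y \<in> E. norm y \<le> 1}"
      then have "B * norm y \<le> \<bar>B\<bar> * 1"
        by (intro mult_mono) auto
      then show "cmod (ev F y) \<le> \<bar>B\<bar>"
        using B[of y] y by simp
    qed
    then have "cmod (ev F ?y) \<le> (SUP y\<in>{y\<in>E. norm y \<le> 1}. cmod (ev F y))"
      using x False csubspaceD(4)[OF csubspace x] by (intro cSUP_upper) auto
    also have "\<dots> = norm F"
      using F is_dual by (simp add: is_dual_def)
    finally show ?thesis
      using False by (simp add: hom field_simps)
  qed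
qed

lemma functional_eqI:
  assumes F: "F \<in> E'" and G: "G \<in> E'" and eq: "\<And>x. x \<in> E \<Longrightarrow> ev F x = ev G x"
  shows "F = G"
proof -
  have "norm (F - G) \<le> 0"
    using eq clinear_on_diff[OF clinear_evaluation csubspace_dual F G]
    by (intro norm_le csubspace_diff[OF csubspace_dual F G]) auto
  then show ?thesis by simp
qed

lemma represent:
  assumes \<phi>: "clinear_on E \<phi>" "\<And>x. x \<in> E \<Longrightarrow> cmod (\<phi> x) \<le> B * norm x" and B: "0 \<le> B"
  shows "\<exists>F\<in>E'. (\<forall>x\<in>E. ev F x = \<phi> x) \<and> norm F \<le> B"
proof -
  have "bounded_functional_on E \<phi>"
    using \<phi> by (auto simp: bounded_functional_on_def)
  then obtain F where F: "F \<in> E'" "\<And>x. x \<in> E \<Longrightarrow> ev F x = \<phi> x"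
    using is_dual unfolding is_dual_def by blast
  have "cmod (ev F x) \<le> B" if "x \<in> E" "norm x \<le> 1" for x
    using \<phi>(2)[OF that(1)] F(2)[OF that(1)] mult_left_mono[OF that(2) B] by simp
  then have "norm F \<le> B"
    by (intro norm_le F(1))
  then show ?thesis using F by blast
qed

section \<open>The weak* topology and the Banach-Alaoglu theorem\<close>

abbreviation weak :: "'u topology" where "weak \<equiv> weak_star E E' ev"

lemma topspace_weak: "topspace weak = E'"
proof -
  have "0 \<in> E" using csubspaceD(1)[OF csubspace] .
  then have "E' \<in> {{F\<in>E'. ev F x \<in> U} |x U. x \<in> E \<and> open U}"
    using open_UNIV by (intro CollectI exI[of _ 0] exI[of _ UNIV]) auto
  then show ?thesis
    unfolding weak_star_def topology_generated_by_topspace by blast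
qed

lemma continuous_map_ev:
  assumes x: "x \<in> E"
  shows "continuous_map weak euclidean (\<lambda>F. ev F x)"
  unfolding continuous_map_def topspace_weak
proof (intro conjI allI impI)
  fix U :: "complex set" assume "openin euclidean U"
  then have "{F \<in> E'. ev F x \<in> U} \<in> {{F\<in>E'. ev F x \<in> U} |x U. x \<in> E \<and> open U}"
    using x by auto
  then show "openin weak {F \<in> E'. ev F x \<in> U}"
    unfolding weak_star_def by (rule topology_generated_by_Basis)
qed auto

lemma continuous_map_into_weak:
  assumes f: "\<And>a. a \<in> topspace T \<Longrightarrow> f a \<in> E'"
    and c: "\<And>x. x \<in> E \<Longrightarrow> continuous_map T euclidean (\<lambda>a. ev (f a) x)"
  shows "continuous_map T weak f"
  unfolding weak_star_def
proof (rule continuous_on_generated_topo)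
  fix V assume "V \<in> {{F\<in>E'. ev F x \<in> U} |x U. x \<in> E \<and> open U}"
  then obtain x U where V: "V = {F\<in>E'. ev F x \<in> U}" "x \<in> E" "open U"
    by auto
  have "openin T {a \<in> topspace T. ev (f a) x \<in> U}"
    using openin_continuous_map_preimage[OF c[OF V(2)]] V(3) by auto
  moreover have "f -` V \<inter> topspace T = {a \<in> topspace T. ev (f a) x \<in> U}"
    using f V(1) by auto
  ultimately show "openin T (f -` V \<inter> topspace T)" by simp
next
  show "f ` topspace T \<subseteq> \<Union> {{F\<in>E'. ev F x \<in> U} |x U. x \<in> E \<and> open U}"
    using f topspace_weak unfolding weak_star_def topology_generated_by_topspace by blast
qed

lemma Hausdorff_weak: "Hausdorff_space weak"
  unfolding Hausdorff_space_def topspace_weak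
proof (intro allI impI)
  fix F G assume FG: "F \<in> E' \<and> G \<in> E' \<and> F \<noteq> G"
  then obtain x where x: "x \<in> E" "ev F x \<noteq> ev G x"
    using functional_eqI by blast
  then obtain U V where "open U" "open V" "ev F x \<in> U" "ev G x \<in> V" "U \<inter> V = {}"
    using hausdorff by metis
  then show "\<exists>U V. openin weak U \<and> openin weak V \<and> F \<in> U \<and> G \<in> V \<and> disjnt U V"
    using FG openin_continuous_map_preimage[OF continuous_map_ev[OF x(1)], of U]
      openin_continuous_map_preimage[OF continuous_map_ev[OF x(1)], of V]
    by (intro exI[of _ "{F \<in> E'. ev F x \<in> U}"] exI[of _ "{F \<in> E'. ev F x \<in> V}"])
      (auto simp: topspace_weak disjnt_def)
qed

text \<open>The ball corresponds to the linear points of the product of the discs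
  \<open>cball 0 (norm x)\<close>, which is compact by Tychonoff. Linearity is an intersection of
  closed conditions, and the passage \<open>G\<close> from a function to the element of
  \<open>E'\<close> that represents it is continuous.\<close>

lemma Banach_Alaoglu: "compactin weak {F\<in>E'. norm F \<le> 1}"
proof -
  define X where "X = product_topology (\<lambda>x::'u. euclidean :: complex topology) E"
  define C where "C = (\<Pi>\<^sub>E x\<in>E. cball (0::complex) (norm x))"
  have C: "compactin X C"
    unfolding X_def C_def by (auto simp: compactin_PiE)
  have pr: "continuous_map X euclidean (\<lambda>\<phi>. \<phi> x)" if "x \<in> E" for x
    unfolding X_def by (rule continuous_map_product_projection[OF that])
  have "closedin X {\<phi> \<in> topspace X. \<phi> (x + y) - \<phi> x - \<phi> y \<in> {0}}" if "x \<in> E" "y \<in> E" for x y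
    using that csubspaceD(2)[OF csubspace]
    by (intro closedin_continuous_map_preimage[where Y = euclidean] continuous_map_diff pr) auto
  moreover have "closedin X {\<phi> \<in> topspace X. \<phi> (c *\<^sub>C x) - c * \<phi> x \<in> {0}}" if "x \<in> E" for x c
  proof -
    have "continuous_map X euclidean (\<lambda>\<phi>. c * \<phi> x)"
      using continuous_map_compose[OF pr[OF that], of euclidean "\<lambda>z. c * z"]
      by (simp add: o_def continuous_on_mult_left)
    then show ?thesis
      using that csubspaceD(3)[OF csubspace]
      by (intro closedin_continuous_map_preimage[where Y = euclidean] continuous_map_diff pr) auto
  qed
  moreover define \<D> where "\<D> =
      (\<Union>x\<in>E. \<Union>y\<in>E. {{\<phi> \<in> topspace X. \<phi> (x + y) - \<phi> x - \<phi> y \<in> {0}}}) \<union>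
      (\<Union>c. \<Union>x\<in>E. {{\<phi> \<in> topspace X. \<phi> (c *\<^sub>C x) - c * \<phi> x \<in> {0}}})"
  ultimately have "closedin X (\<Inter>\<D>)"
    using csubspaceD(1)[OF csubspace] by (intro closedin_Inter) auto
  then have "compactin X (C \<inter> \<Inter>\<D>)"
    using C compact_Int_closedin by blast
  moreover have "C \<subseteq> topspace X"
    using C compactin_subset_topspace by blast
  then have "C \<inter> \<Inter>\<D> = {\<phi> \<in> C. clinear_on E \<phi>}"
    by (auto simp: \<D>_def clinear_on_def scaleC_complex_def subset_iff diff_diff_eq ball_Un)
  ultimately have Z: "compactin X {\<phi> \<in> C. clinear_on E \<phi>}" (is "compactin X ?Z")
    by simp
  have "\<exists>F. F \<in> E' \<and> (\<forall>x\<in>E. ev F x = \<phi> x) \<and> norm F \<le> 1" if "\<phi> \<in> ?Z" for \<phi>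
    using that by (intro represent[of \<phi> 1, simplified Bex_def]) (auto simp: C_def PiE_iff)
  then obtain G where G: "\<And>\<phi>. \<phi> \<in> ?Z \<Longrightarrow> G \<phi> \<in> E' \<and> (\<forall>x\<in>E. ev (G \<phi>) x = \<phi> x) \<and> norm (G \<phi>) \<le> 1"
    by metis
  have ZX: "?Z \<subseteq> topspace X"
    using Z compactin_subset_topspace by blast
  have "continuous_map (subtopology X ?Z) weak G"
  proof (rule continuous_map_into_weak)
    fix x assume x: "x \<in> E"
    show "continuous_map (subtopology X ?Z) euclidean (\<lambda>\<phi>. ev (G \<phi>) x)"
      by (rule continuous_map_eq[OF continuous_map_from_subtopology[OF pr[OF x]]])
        (use G x in auto)
  qed (use G in auto)
  then have "compactin weak (G ` ?Z)"
    using Z by (intro image_compactin[of "subtopology X ?Z"]) (auto simp: compactin_subtopology)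
  moreover have "G ` ?Z = {F\<in>E'. norm F \<le> 1}"
  proof (intro equalityI subsetI)
    fix F assume F: "F \<in> {F\<in>E'. norm F \<le> 1}"
    \<comment> \<open>Points of the extensional product are \<open>undefined\<close> off
      \<open>E\<close>, so the functional is cut down to \<open>E\<close>.\<close>
    define \<phi> where "\<phi> = restrict (ev F) E"
    have "cmod (ev F x) \<le> norm x" if "x \<in> E" for x
      using ev_bound[of F x] mult_right_mono[of "norm F" 1 "norm x"] F that by auto
    moreover have "clinear_on E \<phi>"
      using clinear_functional[of F] F csubspace
      by (auto simp: clinear_on_def \<phi>_def csubspace_def)
    ultimately have \<phi>: "\<phi> \<in> ?Z"
      by (auto simp: C_def \<phi>_def)
    then have "G \<phi> = F"
      using G[OF \<phi>] F by (intro functional_eqI) (auto simp: \<phi>_def)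
    then show "F \<in> G ` ?Z" using \<phi> by blast
  qed (use G in auto)
  ultimately show ?thesis by simp
qed

end

text \<open>The functional \<open>\<lambda>x. evE F (T x)\<close> is bounded by
  \<open>norm F\<close>, so it has a representative of at most that norm; uniqueness of
  representatives makes \<open>T'\<close> linear. The maps \<open>r\<close>, \<open>R\<close>,
  \<open>A\<close> and \<open>N\<close> between levels below arise in this way.\<close>

lemma adjoint_exists:
  assumes D: "dual_pair D D' evD" and E: "dual_pair E E' evE" and T: "contraction_on D E T"
  obtains T' where "contraction_on E' D' T'"
    "\<And>F x. F \<in> E' \<Longrightarrow> x \<in> D \<Longrightarrow> evD (T' F) x = evE F (T x)"
proof -
  interpret D: dual_pair D D' evD by fact
  interpret E: dual_pair E E' evE by fact
  note T = contraction_onD[OF T]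
  have "\<exists>G. G \<in> D' \<and> (\<forall>x\<in>D. evD G x = evE F (T x)) \<and> norm G \<le> norm F" if F: "F \<in> E'" for F
  proof -
    have "clinear_on D (\<lambda>x. evE F (T x))"
      using E.clinear_functional[OF F] T by (auto simp: clinear_on_def)
    moreover have "cmod (evE F (T x)) \<le> norm F * norm x" if "x \<in> D" for x
      using E.ev_bound[OF F T(2)[OF that]] mult_left_mono[OF T(3)[OF that], of "norm F"]
      by simp
    ultimately show ?thesis
      using D.represent[of "\<lambda>x. evE F (T x)" "norm F"] by auto
  qed
  then obtain T' where T': "\<And>F. F \<in> E' \<Longrightarrow>
      T' F \<in> D' \<and> (\<forall>x\<in>D. evD (T' F) x = evE F (T x)) \<and> norm (T' F) \<le> norm F"
    by metis
  have "clinear_on E' T'"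
    unfolding clinear_on_def
  proof (intro conjI ballI allI)
    fix F G assume FG: "F \<in> E'" "G \<in> E'"
    show "T' (F + G) = T' F + T' G"
      using FG T' csubspaceD(2)[OF E.csubspace_dual FG] T(2)
      by (intro D.functional_eqI csubspaceD(2)[OF D.csubspace_dual])
        (auto simp: clinear_onD(1)[OF D.clinear_evaluation] clinear_onD(1)[OF E.clinear_evaluation])
  next
    fix F c assume F: "F \<in> E'"
    show "T' (c *\<^sub>C F) = c *\<^sub>C T' F"
      using F T' csubspaceD(3)[OF E.csubspace_dual F] T(2)
      by (intro D.functional_eqI csubspaceD(3)[OF D.csubspace_dual])
        (auto simp: clinear_onD(2)[OF D.clinear_evaluation] clinear_onD(2)[OF E.clinear_evaluation])
  qed
  then show thesis
    using T' by (intro that[of T']) (auto simp: contraction_on_def)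
qed

lemma complex_eq_of_real_if_Re_ge:
  assumes "r \<le> Re z" "cmod z \<le> r"
  shows "z = complex_of_real r"
proof -
  have r: "Re z = r"
    using assms complex_Re_le_cmod[of z] by linarith
  have "(Re z)\<^sup>2 + (Im z)\<^sup>2 \<le> r\<^sup>2"
    using assms(2) power_mono[of "cmod z" r 2] by (simp add: cmod_power2)
  then show ?thesis using r by (simp add: complex_eq_iff)
qed

section \<open>The Krein-Milman theorem for weak*-compact sets\<close>

context dual_pair
begin

lemma ev_mix:
  assumes "F \<in> E'" "G \<in> E'" "x \<in> E"
  shows "ev ((1 - t) *\<^sub>R F + t *\<^sub>R G) x = (1 - t) *\<^sub>R ev F x + t *\<^sub>R ev G x"
proof -
  note lin = clinear_onD[OF clinear_evaluation[OF assms(3)]]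
  show ?thesis
    unfolding lin(1)[OF csubspaceD(4)[OF csubspace_dual assms(1)] csubspaceD(4)[OF csubspace_dual assms(2)]]
      lin(3)[OF assms(1)] lin(3)[OF assms(2)] ..
qed

text \<open>Real and imaginary parts of the evaluations are continuous affine functions that
  separate points, so \<open>K\<close> with its subspace topology is an instance of
  \<open>compact_convex\<close>. The closure in the larger space adds nothing, as \<open>K\<close>
  is closed by the Hausdorff property.\<close>

lemma weak_closure_hull_extreme_points:
  assumes K: "compactin weak K" "convex K"
  shows "weak closure_of (convex hull {p. p extreme_point_of K}) = K"
proof -
  define T where "T = subtopology weak K"
  have KE: "K \<subseteq> E'"
    using compactin_subset_topspace[OF K(1)] topspace_weak by simp
  have TK: "topspace T = K"
    using KE by (auto simp: T_def topspace_weak)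
  have c: "continuous_map T euclidean (\<lambda>F. ev F x)" if "x \<in> E" for x
    unfolding T_def using continuous_map_from_subtopology[OF continuous_map_ev[OF that]] .
  interpret compact_convex T
  proof
    show "compact_space T"
      unfolding T_def using K(1) by (rule compact_space_subtopology)
    show "convex (topspace T)" using K(2) TK by simp
  next
    fix a b assume ab: "a \<in> topspace T" "b \<in> topspace T" "a \<noteq> b"
    then obtain x where x: "x \<in> E" "ev a x \<noteq> ev b x"
      using KE TK functional_eqI by blast
    have "affine_continuous T (\<lambda>F. g (ev F x))" if g: "bounded_linear g" for g :: "complex \<Rightarrow> real"
      unfolding affine_continuous_def
    proof (intro conjI ballI)
      have "continuous_map euclidean euclideanreal g"
        using linear_continuous_on[OF g] by simp
      from continuous_map_compose[OF c[OF x(1)] this] show "continuous_map T euclideanreal (\<lambda>F. g (ev F x))"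
        by (simp add: o_def)
      fix a b and t :: real assume "a \<in> topspace T" "b \<in> topspace T"
      then show "g (ev ((1 - t) *\<^sub>R a + t *\<^sub>R b) x) = (1 - t) * g (ev a x) + t * g (ev b x)"
        using KE TK x(1) g by (subst ev_mix) (auto simp: linear_simps)
    qed
    moreover have "Re (ev a x) \<noteq> Re (ev b x) \<or> Im (ev a x) \<noteq> Im (ev b x)"
      using x(2) by (simp add: complex_eq_iff)
    ultimately show "\<exists>h. affine_continuous T h \<and> h a \<noteq> h b"
      using bounded_linear_Re bounded_linear_Im by blast
  next
    fix b and t :: real assume b: "b \<in> topspace T" and t: "t \<in> {0..1}"
    have "continuous_map T weak (\<lambda>a. (1 - t) *\<^sub>R a + t *\<^sub>R b)"
    proof (rule continuous_map_into_weak)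
      fix a assume "a \<in> topspace T"
      then show "(1 - t) *\<^sub>R a + t *\<^sub>R b \<in> E'"
        using b KE TK csubspaceD(2,4)[OF csubspace_dual] by blast
    next
      fix x assume x: "x \<in> E"
      have "continuous_map euclidean euclidean (\<lambda>z. (1 - t) *\<^sub>R z + t *\<^sub>R ev b x)"
        by (auto intro!: continuous_intros)
      from continuous_map_compose[OF c[OF x] this]
      have "continuous_map T euclidean (\<lambda>a. (1 - t) *\<^sub>R ev a x + t *\<^sub>R ev b x)"
        by (simp add: o_def)
      then show "continuous_map T euclidean (\<lambda>a. ev ((1 - t) *\<^sub>R a + t *\<^sub>R b) x)"
        by (rule continuous_map_eq) (use b KE TK x in \<open>auto simp: ev_mix subset_iff\<close>)
    qed
    moreover have "(1 - t) *\<^sub>R a + t *\<^sub>R b \<in> K" if "a \<in> K" for a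
      using K(2) that b t TK by (auto simp: convex_alt)
    ultimately show "continuous_map T T (\<lambda>a. (1 - t) *\<^sub>R a + t *\<^sub>R b)"
      using TK by (subst (2) T_def) (auto simp: continuous_map_in_subtopology)
  qed
  let ?H = "convex hull {p. p extreme_point_of K}"
  have H: "?H \<subseteq> K"
    using K(2) by (intro hull_minimal) (auto simp: extreme_point_of_def)
  have "T closure_of ?H = K"
    using Krein_Milman TK by simp
  then have "K \<subseteq> weak closure_of ?H"
    using closure_of_mono[of "K \<inter> ?H" ?H weak] unfolding T_def closure_of_subtopology by blast
  moreover have "closedin weak K"
    using compactin_imp_closedin[OF Hausdorff_weak K(1)] .
  ultimately show ?thesis
    using closure_of_minimal[OF H] by blast
qed

lemma compactin_norming:
  assumes "x \<in> E"
  shows "compactin weak {F\<in>E'. norm F \<le> 1 \<and> ev F x = c}"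
proof -
  have "closedin weak {F \<in> topspace weak. ev F x \<in> {c}}"
    using continuous_map_ev[OF assms] by (rule closedin_continuous_map_preimage) simp
  from compact_Int_closedin[OF Banach_Alaoglu this] show ?thesis
    by (rule back_subst[of "compactin weak"]) (auto simp: topspace_weak)
qed

lemma convex_norming:
  assumes "x \<in> E"
  shows "convex {F\<in>E'. norm F \<le> 1 \<and> ev F x = c}"
proof -
  have "convex {F\<in>E'. ev F x = c}"
    unfolding convex_alt
    by (auto simp: ev_mix assms csubspaceD(2,4)[OF csubspace_dual] simp flip: scaleR_add_left
      simp del: scaleR_left_diff_distrib)
  then have "convex ({F\<in>E'. ev F x = c} \<inter> cball 0 1)"
    by (intro convex_Int convex_cball)
  then show ?thesis
    by (rule back_subst[of convex]) auto
qed

end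

subsection \<open>Towers of duals\<close>

locale tower =
  fixes S :: "nat \<Rightarrow> 'u::complex_banach set" and ev :: "nat \<Rightarrow> 'u \<Rightarrow> 'u \<Rightarrow> complex" and m :: nat
  assumes dual_tower: "dual_tower S ev m"
begin

text \<open>The upper level \<open>l\<close> is a variable of its own so that instances can be
  stated with \<open>S 3\<close> or \<open>S (2 * n + 1)\<close>.\<close>

lemma dual_pair:
  assumes "k < m" "l = Suc k"
  shows "dual_pair (S k) (S l) (ev k)"
proof
  show "is_dual (S k) (S l) (ev k)"
    using dual_tower assms by (simp add: dual_tower_def)
  show "csubspace (S k)"
    using dual_tower assms by (cases k) (auto simp: dual_tower_def is_dual_def)
qed

text \<open>The description in \<open>canon\<close> is proper: \<open>represent\<close> provides
  such an element with the norm bound, and \<open>functional_eqI\<close> its uniqueness.\<close>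

lemma canon_level:
  assumes k: "l < m" "l = Suc k" and x: "x \<in> S k"
  shows "canon S ev k x \<in> S (Suc l) \<and> (\<forall>f\<in>S l. ev l (canon S ev k x) f = ev k f x) \<and>
    norm (canon S ev k x) \<le> norm x"
proof -
  interpret D: dual_pair "S k" "S l" "ev k" using dual_pair k by simp
  interpret E: dual_pair "S l" "S (Suc l)" "ev l" using dual_pair k by simp
  have "cmod (ev k f x) \<le> norm x * norm f" if "f \<in> S l" for f
    using D.ev_bound[OF that x] by (simp add: mult.commute)
  then obtain y where y: "y \<in> S (Suc l)" "\<And>f. f \<in> S l \<Longrightarrow> ev l y f = ev k f x" "norm y \<le> norm x"
    using E.represent[OF D.clinear_evaluation[OF x], of "norm x"] by auto
  have "canon S ev k x = y"
    unfolding canon_def using y k(2) by (intro the_equality) (auto intro!: E.functional_eqI)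
  then show ?thesis using y by simp
qed

lemma ev_canon:
  "l < m \<Longrightarrow> l = Suc k \<Longrightarrow> x \<in> S k \<Longrightarrow> f \<in> S l \<Longrightarrow> ev l (canon S ev k x) f = ev k f x"
  using canon_level by blast

lemma contraction_canon:
  assumes k: "Suc k < m" "l = Suc (Suc k)"
  shows "contraction_on (S k) (S l) (canon S ev k)"
proof -
  interpret D: dual_pair "S k" "S (Suc k)" "ev k" using dual_pair k by simp
  interpret E: dual_pair "S (Suc k)" "S l" "ev (Suc k)" using dual_pair k by simp
  note c = canon_level[OF k(1) refl, folded k(2)]
  have "canon S ev k (x + y) = canon S ev k x + canon S ev k y" if "x \<in> S k" "y \<in> S k" for x y
    using c[OF that(1)] c[OF that(2)] c[OF csubspaceD(2)[OF D.csubspace that]] that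
    by (intro E.functional_eqI csubspaceD(2)[OF E.csubspace_dual])
      (auto simp: clinear_onD(1)[OF E.clinear_evaluation] clinear_onD(1)[OF D.clinear_functional])
  moreover have "canon S ev k (a *\<^sub>C x) = a *\<^sub>C canon S ev k x" if "x \<in> S k" for a x
    using c[OF that] c[OF csubspaceD(3)[OF D.csubspace that]] that
    by (intro E.functional_eqI csubspaceD(3)[OF E.csubspace_dual])
      (auto simp: clinear_onD(2)[OF E.clinear_evaluation] clinear_onD(2)[OF D.clinear_functional])
  ultimately show ?thesis
    using c by (auto simp: contraction_on_def clinear_on_def)
qed

lemma contraction_canon_iter:
  "k + 2 * j \<le> m \<Longrightarrow> contraction_on (S k) (S (k + 2 * j)) (canon_iter S ev k j)"
proof (induction j)
  case 0
  then show ?case using contraction_on_id by (simp add: contraction_on_def clinear_on_def)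
next
  case (Suc j)
  then show ?case
    using contraction_on_compose[OF Suc.IH contraction_canon[of "k + 2 * j" "k + 2 * Suc j"]]
    by (simp add: contraction_on_def clinear_on_def)
qed

text \<open>An induction step lifts both arguments: evaluating the lifted \<open>f\<close> at the
  lifted \<open>x\<close> is evaluating the lifted \<open>x\<close> at \<open>f\<close>, which is
  evaluating \<open>f\<close> at \<open>x\<close>.\<close>

lemma ev_canon_iter:
  assumes "Suc (k + 2 * j) \<le> m" "x \<in> S k" "f \<in> S (Suc k)"
  shows "ev (k + 2 * j) (canon_iter S ev (Suc k) j f) (canon_iter S ev k j x) = ev k f x"
  using assms(1)
proof (induction j)
  case (Suc j)
  let ?x = "canon_iter S ev k j x" and ?f = "canon_iter S ev (Suc k) j f"
  have x: "?x \<in> S (k + 2 * j)" and f: "?f \<in> S (Suc (k + 2 * j))"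
    using contraction_onD(2)[OF contraction_canon_iter[of k j]]
      contraction_onD(2)[OF contraction_canon_iter[of "Suc k" j]] Suc.prems assms(2,3) by auto
  have cx: "canon S ev (k + 2 * j) ?x \<in> S (Suc (Suc (k + 2 * j)))"
    "ev (Suc (k + 2 * j)) (canon S ev (k + 2 * j) ?x) ?f = ev (k + 2 * j) ?f ?x"
    using canon_level[of "Suc (k + 2 * j)" "k + 2 * j" ?x] x f Suc.prems by auto
  moreover have "ev (Suc (Suc (k + 2 * j))) (canon S ev (Suc (k + 2 * j)) ?f) (canon S ev (k + 2 * j) ?x)
      = ev (Suc (k + 2 * j)) (canon S ev (k + 2 * j) ?x) ?f"
    using canon_level[of "Suc (Suc (k + 2 * j))" "Suc (k + 2 * j)" ?f] f cx(1) Suc.prems by auto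
  ultimately show ?case
    using Suc by simp
qed simp

text \<open>The recursion of \<open>canon_iter\<close> splits off the last embedding; splitting off
  the first one relates chains from \<open>S 0\<close> and \<open>S 1\<close> to chains from
  \<open>S 2\<close> and \<open>S 3\<close>.\<close>

lemma canon_iter_Suc_shift:
  "canon_iter S ev k (Suc j) x = canon_iter S ev (Suc (Suc k)) j (canon S ev k x)"
  by (induction j) simp_all

section \<open>The L-decomposition of the odd duals\<close>

text \<open>The odd dual is the L-sum of the copy of \<open>S 1\<close> and the annihilator of the
  copy of \<open>S 0\<close>, with \<open>f\<close> the restriction of \<open>\<Lambda>\<close> to
  \<open>S 0\<close>. The reverse norm inequality is the triangle inequality, the embedding being
  contractive.\<close>

definition L_split :: "nat \<Rightarrow> bool" where
  "L_split n \<longleftrightarrow> (\<forall>\<Lambda>\<in>S (Suc (2 * n)). \<exists>f\<in>S 1.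
     norm f + norm (\<Lambda> - canon_iter S ev 1 n f) \<le> norm \<Lambda> \<and>
     (\<forall>x\<in>S 0. ev (2 * n) \<Lambda> (canon_iter S ev 0 n x) = ev 0 f x))"

text \<open>Any contractive projection with the same kernel as an \<open>L\<close>-projection coincides with it.
  Hence the projection given by the \<open>M\<close>-ideal property is the restriction to the predual.\<close>

lemma L_split_1:
  assumes m: "3 \<le> m" and M: "M_ideal (canon S ev 0 ` S 0) (S 2) (S 3) (ev 2)"
  shows "L_split 1"
proof -
  interpret p0: dual_pair "S 0" "S 1" "ev 0" by (rule dual_pair) (use m in simp_all)
  interpret p1: dual_pair "S 1" "S 2" "ev 1" by (rule dual_pair) (use m in simp_all)
  interpret p2: dual_pair "S 2" "S 3" "ev 2" by (rule dual_pair) (use m in simp_all)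
  have c0: "contraction_on (S 0) (S 2) (canon S ev 0)" and c1: "contraction_on (S 1) (S 3) (canon S ev 1)"
    using contraction_canon[of 0 2] contraction_canon[of 1 3] m by auto
  \<comment> \<open>\<open>r\<close> restricts functionals on the bidual to \<open>S 0\<close>. With
    \<open>rc1\<close>, the map \<open>F \<mapsto> canon S ev 1 (r F)\<close> is a contractive
    projection whose kernel is the annihilator of the copy of \<open>S 0\<close>.\<close>
  obtain r where r: "contraction_on (S 3) (S 1) r"
    "\<And>\<Lambda> x. \<Lambda> \<in> S 3 \<Longrightarrow> x \<in> S 0 \<Longrightarrow> ev 0 (r \<Lambda>) x = ev 2 \<Lambda> (canon S ev 0 x)"
    using adjoint_exists[OF p0.dual_pair_axioms p2.dual_pair_axioms c0] by blast
  note c0 = contraction_onD[OF c0] and c1 = contraction_onD[OF c1] and rc = contraction_onD[OF r(1)]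
  have ev0: "ev 1 (canon S ev 0 x) f = ev 0 f x" if "x \<in> S 0" "f \<in> S 1" for x f
    by (rule ev_canon) (use that m in simp_all)
  have ev1: "ev 2 (canon S ev 1 f) \<tau> = ev 1 \<tau> f" if "f \<in> S 1" "\<tau> \<in> S 2" for \<tau> f
    by (rule ev_canon) (use that m in simp_all)
  have rc1: "r (canon S ev 1 f) = f" if "f \<in> S 1" for f
    using that rc(2) c0(2) c1(2) by (intro p0.functional_eqI) (auto simp: r(2) ev0 ev1 simp del: One_nat_def)
  obtain P where P: "P ` S 3 \<subseteq> S 3" "\<And>F. F \<in> S 3 \<Longrightarrow> P (P F) = P F" "clinear_on (S 3) P"
      "{F\<in>S 3. P F = 0} = annihilator (S 3) (ev 2) (canon S ev 0 ` S 0)"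
      "\<And>F. F \<in> S 3 \<Longrightarrow> norm F = norm (P F) + norm (F - P F)"
    using M unfolding M_ideal_def by blast
  have PS: "P F \<in> S 3" if "F \<in> S 3" for F using P(1) that by blast
  have sub: "F - G \<in> S 3" if "F \<in> S 3" "G \<in> S 3" for F G
    using csubspace_diff[OF p2.csubspace_dual that] .
  have ker: "P F = 0 \<longleftrightarrow> r F = 0" if F: "F \<in> S 3" for F
  proof -
    have "P F = 0 \<longleftrightarrow> (\<forall>x\<in>S 0. ev 2 F (canon S ev 0 x) = 0)"
      using P(4) F by (auto simp: annihilator_def)
    also have "\<dots> \<longleftrightarrow> (\<forall>x\<in>S 0. ev 0 (r F) x = ev 0 0 x)"
      using r(2)[OF F] clinear_onD(2)[OF p0.clinear_evaluation csubspaceD(1)[OF p0.csubspace_dual], of _ 0]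
      by (simp add: scaleC_complex_def scaleC_zero)
    also have "\<dots> \<longleftrightarrow> r F = 0"
      using p0.functional_eqI[OF rc(2)[OF F] csubspaceD(1)[OF p0.csubspace_dual]] by auto
    finally show ?thesis .
  qed
  have Pr: "P F = canon S ev 1 (r F)" if F: "F \<in> S 3" for F
  proof -
    define Q where "Q = canon S ev 1 (r F)"
    have Q: "Q \<in> S 3" "r Q = r F"
      using rc(2)[OF F] c1(2) rc1 by (auto simp: Q_def)
    have "P (Q - P Q) = 0"
      using clinear_on_diff[OF P(3) p2.csubspace_dual Q(1) PS[OF Q(1)]] P(2)[OF Q(1)] by simp
    then have "r (Q - P Q) = 0"
      using ker sub PS Q by blast
    then have "r (P Q) = r Q"
      using clinear_on_diff[OF rc(1) p2.csubspace_dual Q(1) PS[OF Q(1)]] by simp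
    \<comment> \<open>\<open>Q\<close> and \<open>P Q\<close> have the same restriction, and
      \<open>Q\<close> is the canonical image of it, so \<open>Q\<close> has the smaller norm. The
      L-identity for \<open>Q\<close> then leaves nothing for \<open>Q - P Q\<close>.\<close>
    then have "norm Q \<le> norm (P Q)"
      using c1(3)[OF rc(2)[OF F]] rc(3)[OF PS[OF Q(1)]] Q(2) by (simp add: Q_def)
    then have PQ: "P Q = Q"
      using P(5)[OF Q(1)] by simp
    have "r (F - Q) = 0"
      using clinear_on_diff[OF rc(1) p2.csubspace_dual F Q(1)] Q(2) by simp
    then have "P (F - Q) = 0"
      using ker sub F Q by blast
    then show ?thesis
      using clinear_on_diff[OF P(3) p2.csubspace_dual F Q(1)] PQ by (simp add: Q_def)
  qed
  show ?thesis
    unfolding L_split_def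
  proof
    fix \<Lambda> assume "\<Lambda> \<in> S (Suc (2 * 1))"
    then have L: "\<Lambda> \<in> S 3" by (simp add: numeral_3_eq_3)
    have "norm (r \<Lambda>) + norm (\<Lambda> - canon S ev 1 (r \<Lambda>)) \<le> norm \<Lambda>"
      using P(5)[OF L] rc1[OF rc(2)[OF L]] rc(3)[OF c1(2)[OF rc(2)[OF L]]] by (simp add: Pr[OF L])
    then show "\<exists>f\<in>S 1. norm f + norm (\<Lambda> - canon_iter S ev 1 1 f) \<le> norm \<Lambda> \<and>
       (\<forall>x\<in>S 0. ev (2 * 1) \<Lambda> (canon_iter S ev 0 1 x) = ev 0 f x)"
      using r(2)[OF L] rc(2)[OF L] by (intro bexI[of _ "r \<Lambda>"]) auto
  qed
qed

text \<open>Dualising the L-decomposition of \<open>S (2 * n + 1)\<close> gives an M-decomposition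
  of \<open>S (2 * n + 2)\<close>, one summand being a copy of \<open>S 2\<close>. Pulled back to
  that summand, \<open>\<Lambda>\<close> becomes an element of \<open>S 3\<close>, which splits by
  \<open>L_split 1\<close>; its values on the other summand are estimated separately.\<close>

lemma L_split_Suc:
  assumes m: "2 * n + 3 \<le> m" and n: "1 \<le> n" and L1: "L_split 1" and Ln: "L_split n"
  shows "L_split (Suc n)"
proof -
  let ?J = "canon_iter S ev 1 n" and ?\<iota> = "canon_iter S ev 0 n"
  let ?a = "2 * n" and ?b = "2 * n + 1" and ?c = "2 * n + 2" and ?d = "2 * n + 3"
  interpret p0: dual_pair "S 0" "S 1" "ev 0" by (rule dual_pair) (use m in simp_all)
  interpret p1: dual_pair "S 1" "S 2" "ev 1" by (rule dual_pair) (use m in simp_all)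
  interpret p2: dual_pair "S 2" "S 3" "ev 2" by (rule dual_pair) (use m in simp_all)
  interpret a: dual_pair "S ?a" "S ?b" "ev ?a" by (rule dual_pair) (use m in simp_all)
  interpret b: dual_pair "S ?b" "S ?c" "ev ?b" by (rule dual_pair) (use m in simp_all)
  interpret c: dual_pair "S ?c" "S ?d" "ev ?c" by (rule dual_pair) (use m in simp_all)
  have iota: "contraction_on (S 0) (S ?a) ?\<iota>" and J: "contraction_on (S 1) (S ?b) ?J"
    using contraction_canon_iter[of 0 n] contraction_canon_iter[of 1 n] m by auto
  \<comment> \<open>\<open>r\<close> restricts to \<open>S 0\<close>, its adjoint \<open>R\<close>
    puts \<open>S 2\<close> into \<open>S (2 * n + 2)\<close>, the adjoint \<open>A\<close> of
    \<open>?J\<close> restricts to \<open>S 1\<close>, and the adjoint \<open>N\<close> of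
    \<open>R\<close> pulls functionals on \<open>S (2 * n + 2)\<close> back to
    \<open>S 2\<close>.\<close>
  obtain r where r: "contraction_on (S ?b) (S 1) r"
    "\<And>F x. F \<in> S ?b \<Longrightarrow> x \<in> S 0 \<Longrightarrow> ev 0 (r F) x = ev ?a F (?\<iota> x)"
    using adjoint_exists[OF p0.dual_pair_axioms a.dual_pair_axioms iota] by blast
  obtain R where R: "contraction_on (S 2) (S ?c) R"
    "\<And>\<sigma> F. \<sigma> \<in> S 2 \<Longrightarrow> F \<in> S ?b \<Longrightarrow> ev ?b (R \<sigma>) F = ev 1 \<sigma> (r F)"
    using adjoint_exists[OF b.dual_pair_axioms p1.dual_pair_axioms r(1)] by blast
  obtain A where A: "contraction_on (S ?c) (S 2) A"
    "\<And>\<Phi> f. \<Phi> \<in> S ?c \<Longrightarrow> f \<in> S 1 \<Longrightarrow> ev 1 (A \<Phi>) f = ev ?b \<Phi> (?J f)"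
    using adjoint_exists[OF p1.dual_pair_axioms b.dual_pair_axioms J] by blast
  obtain N where N: "contraction_on (S ?d) (S 3) N"
    "\<And>\<Lambda> \<sigma>. \<Lambda> \<in> S ?d \<Longrightarrow> \<sigma> \<in> S 2 \<Longrightarrow> ev 2 (N \<Lambda>) \<sigma> = ev ?c \<Lambda> (R \<sigma>)"
    using adjoint_exists[OF p2.dual_pair_axioms c.dual_pair_axioms R(1)] by blast
  note J = contraction_onD[OF J] and iota = contraction_onD[OF iota] and rc = contraction_onD[OF r(1)]
    and Rc = contraction_onD[OF R(1)] and Ac = contraction_onD[OF A(1)] and Nc = contraction_onD[OF N(1)]
  have split: "norm (r F) + norm (F - ?J (r F)) \<le> norm F" if F: "F \<in> S ?b" for F
  proof -
    obtain f where f: "f \<in> S 1" "norm f + norm (F - ?J f) \<le> norm F"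
       "\<And>x. x \<in> S 0 \<Longrightarrow> ev ?a F (?\<iota> x) = ev 0 f x"
      using Ln F unfolding L_split_def by auto
    have "r F = f"
      using f r(2)[OF F] by (intro p0.functional_eqI rc(2) F) auto
    then show ?thesis using f by simp
  qed
  have "\<exists>f\<in>S 1. norm f + norm (\<Lambda> - canon_iter S ev 1 (Suc n) f) \<le> norm \<Lambda> \<and>
     (\<forall>x\<in>S 0. ev ?c \<Lambda> (canon_iter S ev 0 (Suc n) x) = ev 0 f x)" if L: "\<Lambda> \<in> S ?d" for \<Lambda>
  proof -
    define M where "M = N \<Lambda>"
    have M: "M \<in> S 3" "\<And>\<sigma>. \<sigma> \<in> S 2 \<Longrightarrow> ev 2 M \<sigma> = ev ?c \<Lambda> (R \<sigma>)"
      using Nc N(2) L by (auto simp: M_def)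
    obtain f where f: "f \<in> S 1" "norm f + norm (M - canon S ev 1 f) \<le> norm M"
       "\<And>x. x \<in> S 0 \<Longrightarrow> ev 2 M (canon S ev 0 x) = ev 0 f x"
      using L1 M(1) unfolding L_split_def by (auto simp: numeral_3_eq_3 numeral_2_eq_2)
    define B where "B = \<Lambda> - canon S ev ?b (?J f)"
    have Jf: "?J f \<in> S ?b" using J(2) f(1) .
    have cJf: "canon S ev ?b (?J f) \<in> S ?d"
      "\<And>\<Phi>. \<Phi> \<in> S ?c \<Longrightarrow> ev ?c (canon S ev ?b (?J f)) \<Phi> = ev ?b \<Phi> (?J f)"
      using canon_level[of ?c ?b "?J f"] Jf m by (auto simp: eval_nat_numeral)
    have cf: "canon S ev 1 f \<in> S 3" "\<And>\<sigma>. \<sigma> \<in> S 2 \<Longrightarrow> ev 2 (canon S ev 1 f) \<sigma> = ev 1 \<sigma> f"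
      using canon_level[of 2 1 f] f(1) m by (auto simp: eval_nat_numeral)
    have BS: "B \<in> S ?d"
      unfolding B_def using csubspace_diff[OF c.csubspace_dual L cJf(1)] .
    have "norm f + norm B \<le> norm \<Lambda>"
    proof -
      have "cmod (ev ?c B \<Phi>) \<le> norm \<Lambda> - norm f" if \<Phi>: "\<Phi> \<in> S ?c" "norm \<Phi> \<le> 1" for \<Phi>
      proof -
        \<comment> \<open>\<open>z\<close> is the value of \<open>\<Lambda>\<close> on the part of
          \<open>\<Phi>\<close> complementary to \<open>R (A \<Phi>)\<close>; the rest of
          \<open>ev ?c B \<Phi>\<close> is the value of \<open>M - canon S ev 1 f\<close> at
          \<open>A \<Phi>\<close>.\<close>
        define z where "z = ev ?c \<Lambda> (\<Phi> - R (A \<Phi>))"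
        have RA: "R (A \<Phi>) \<in> S ?c" using Rc(2) Ac(2) \<Phi> by blast
        have PRA: "\<Phi> - R (A \<Phi>) \<in> S ?c" using csubspace_diff[OF c.csubspace \<Phi>(1) RA] .
        have "ev ?c B \<Phi> = ev ?c \<Lambda> \<Phi> - ev 1 (A \<Phi>) f"
          unfolding B_def
          using clinear_on_diff[OF c.clinear_evaluation[OF \<Phi>(1)] c.csubspace_dual L cJf(1)] cJf(2)[OF \<Phi>(1)]
            A(2)[OF \<Phi>(1) f(1)] by simp
        also have "\<dots> = z + (ev 2 M (A \<Phi>) - ev 2 (canon S ev 1 f) (A \<Phi>))"
          using M(2) cf(2) Ac(2)[OF \<Phi>(1)] clinear_on_diff[OF c.clinear_functional[OF L] c.csubspace \<Phi>(1) RA]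
          by (simp add: z_def)
        also have "\<dots> = z + ev 2 (M - canon S ev 1 f) (A \<Phi>)"
          using clinear_on_diff[OF p2.clinear_evaluation[OF Ac(2)[OF \<Phi>(1)]] p2.csubspace_dual M(1) cf(1)]
          by simp
        finally have "cmod (ev ?c B \<Phi>) \<le> cmod z + cmod (ev 2 (M - canon S ev 1 f) (A \<Phi>))"
          by (simp add: norm_triangle_ineq)
        also have "cmod (ev 2 (M - canon S ev 1 f) (A \<Phi>)) \<le> norm (M - canon S ev 1 f) * norm (A \<Phi>)"
          using p2.ev_bound[OF csubspace_diff[OF p2.csubspace_dual M(1) cf(1)] Ac(2)[OF \<Phi>(1)]] .
        also have "\<dots> \<le> norm (M - canon S ev 1 f) * 1"
          using Ac(3)[OF \<Phi>(1)] \<Phi>(2) by (intro mult_left_mono) auto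
        finally have 1: "cmod (ev ?c B \<Phi>) \<le> cmod z + norm (M - canon S ev 1 f)" by simp
        \<comment> \<open>Each \<sigma> in the unit ball is pushed through \<open>R\<close> and
          enlarged by the complementary part of \<Phi>, turned by the phase \<open>u\<close> so that
          it contributes \<open>cmod z\<close> to the value of \<Lambda>.\<close>
        have "norm M \<le> norm \<Lambda> - cmod z"
        proof (rule p2.norm_le_Re[OF M(1)])
          fix \<sigma> assume s: "\<sigma> \<in> S 2" "norm \<sigma> \<le> 1"
          obtain u where u: "cmod u \<le> 1" "u * z = complex_of_real (cmod z)"
            by (rule phase_exists)
          \<comment> \<open>\<open>R \<circ> A\<close> is the \<open>M\<close>-projection dual to the \<open>L\<close>-projection \<open>?J \<circ> r\<close>, so \<open>\<Psi>\<close> stays in the unit ball.\<close>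
          define \<Psi> where "\<Psi> = R \<sigma> + u *\<^sub>C (\<Phi> - R (A \<Phi>))"
          have uS: "u *\<^sub>C (\<Phi> - R (A \<Phi>)) \<in> S ?c" using csubspaceD(3)[OF c.csubspace PRA] .
          have \<Psi>: "\<Psi> \<in> S ?c"
            unfolding \<Psi>_def using csubspaceD(2)[OF c.csubspace Rc(2)[OF s(1)] uS] .
          have "norm \<Psi> \<le> 1"
          proof (rule b.norm_le[OF \<Psi>])
            fix F assume F: "F \<in> S ?b" "norm F \<le> 1"
            have rF: "r F \<in> S 1" "?J (r F) \<in> S ?b" "F - ?J (r F) \<in> S ?b"
              using rc(2)[OF F(1)] J(2) csubspace_diff[OF b.csubspace F(1)] by auto
            have "ev ?b \<Psi> F = ev ?b (R \<sigma>) F + u * (ev ?b \<Phi> F - ev ?b (R (A \<Phi>)) F)"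
              unfolding \<Psi>_def
              using clinear_onD(1)[OF b.clinear_evaluation[OF F(1)] Rc(2)[OF s(1)] uS]
                clinear_onD(2)[OF b.clinear_evaluation[OF F(1)] PRA]
                clinear_on_diff[OF b.clinear_evaluation[OF F(1)] c.csubspace \<Phi>(1) RA]
              by (simp add: scaleC_complex_def)
            also have "\<dots> = ev 1 \<sigma> (r F) + u * (ev ?b \<Phi> F - ev ?b \<Phi> (?J (r F)))"
              using R(2)[OF s(1) F(1)] R(2)[OF Ac(2)[OF \<Phi>(1)] F(1)] A(2)[OF \<Phi>(1) rF(1)] by simp
            also have "\<dots> = ev 1 \<sigma> (r F) + u * ev ?b \<Phi> (F - ?J (r F))"
              using clinear_on_diff[OF b.clinear_functional[OF \<Phi>(1)] b.csubspace F(1) rF(2)] by simp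
            finally have "cmod (ev ?b \<Psi> F) \<le> cmod (ev 1 \<sigma> (r F)) + cmod (u * ev ?b \<Phi> (F - ?J (r F)))"
              by (simp add: norm_triangle_ineq)
            also have "cmod (ev 1 \<sigma> (r F)) \<le> 1 * norm (r F)"
              using p1.ev_bound[OF s(1) rF(1)] mult_right_mono[OF s(2) norm_ge_zero[of "r F"]] by linarith
            also have "cmod (u * ev ?b \<Phi> (F - ?J (r F))) \<le> 1 * norm (F - ?J (r F))"
              unfolding norm_mult
            proof (rule mult_mono[OF u(1)])
              show "cmod (ev ?b \<Phi> (F - ?J (r F))) \<le> norm (F - ?J (r F))"
                using b.ev_bound[OF \<Phi>(1) rF(3)] mult_right_mono[OF \<Phi>(2) norm_ge_zero[of "F - ?J (r F)"]]
                by linarith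
            qed auto
            finally show "cmod (ev ?b \<Psi> F) \<le> 1"
              using split[OF F(1)] F(2) by simp
          qed
          then have "cmod (ev ?c \<Lambda> \<Psi>) \<le> norm \<Lambda>"
            using c.ev_bound[OF L \<Psi>] mult_left_mono[of "norm \<Psi>" 1 "norm \<Lambda>"] by simp
          then have "Re (ev ?c \<Lambda> \<Psi>) \<le> norm \<Lambda>"
            using complex_Re_le_cmod order_trans by blast
          moreover have "ev ?c \<Lambda> \<Psi> = ev 2 M \<sigma> + complex_of_real (cmod z)"
            unfolding \<Psi>_def
            using clinear_onD(1)[OF c.clinear_functional[OF L] Rc(2)[OF s(1)] uS]
              clinear_onD(2)[OF c.clinear_functional[OF L] PRA] M(2)[OF s(1)] u(2)
            by (simp add: scaleC_complex_def z_def)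
          ultimately show "Re (ev 2 M \<sigma>) \<le> norm \<Lambda> - cmod z" by simp
        qed
        then show ?thesis using 1 f(2) by linarith
      qed
      then have "norm B \<le> norm \<Lambda> - norm f"
        by (rule c.norm_le[OF BS])
      then show ?thesis by simp
    qed
    moreover have "ev ?c \<Lambda> (canon S ev ?a (?\<iota> x)) = ev 0 f x" if x: "x \<in> S 0" for x
    proof -
      have ix: "canon S ev ?a (?\<iota> x) \<in> S ?c"
        "\<And>F. F \<in> S ?b \<Longrightarrow> ev ?b (canon S ev ?a (?\<iota> x)) F = ev ?a F (?\<iota> x)"
        using canon_level[of ?b ?a "?\<iota> x"] iota(2)[OF x] m by auto
      have cx1: "canon S ev 0 x \<in> S 2"
        by (rule contraction_onD(2)[OF contraction_canon[of 0 2] x]) (use m in simp_all)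
      have cx2: "ev 1 (canon S ev 0 x) g = ev 0 g x" if "g \<in> S 1" for g
        by (rule ev_canon) (use x m that in simp_all)
      \<comment> \<open>On the copy of \<open>S 0\<close> the map \<open>R\<close> is the canonical
        one, so \<open>f\<close>, found as the restriction of \<open>M\<close>, is also the
        restriction of \<open>\<Lambda>\<close>.\<close>
      have "R (canon S ev 0 x) = canon S ev ?a (?\<iota> x)"
      proof (rule b.functional_eqI[OF Rc(2)[OF cx1] ix(1)])
        fix F assume F: "F \<in> S ?b"
        show "ev ?b (R (canon S ev 0 x)) F = ev ?b (canon S ev ?a (?\<iota> x)) F"
          unfolding R(2)[OF cx1 F] ix(2)[OF F] cx2[OF rc(2)[OF F]] r(2)[OF F x] ..
      qed
      then show ?thesis
        using M(2)[OF cx1] f(3)[OF x] by simp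
    qed
    ultimately show ?thesis
      using f(1) by (intro bexI[of _ f]) (auto simp: B_def)
  qed
  then show ?thesis
    unfolding L_split_def by (simp add: eval_nat_numeral)
qed

lemma L_split:
  assumes n: "1 \<le> n" "2 * n + 1 \<le> m" and M: "M_ideal (canon S ev 0 ` S 0) (S 2) (S 3) (ev 2)"
  shows "L_split n"
  using n
proof (induction n rule: nat_induct_at_least)
  case base
  then show ?case using L_split_1[OF _ M] by simp
next
  case (Suc n)
  then show ?case using L_split_Suc[of n] L_split_1[OF _ M] by simp
qed

section \<open>Functionals norming \<tau>\<close>

lemma contraction_canon_iter_bidual:
  assumes "1 \<le> n" "2 * n \<le> m"
  shows "contraction_on (S 2) (S (2 * n)) (canon_iter S ev 2 (n - 1))"
proof -
  have "2 + 2 * (n - 1) = 2 * n" using assms(1) by simp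
  then show ?thesis
    using contraction_canon_iter[of 2 "n - 1"] assms(2) by metis
qed

text \<open>\<open>f\<close> starts one level below \<tau> and is embedded once more. Its first
  embedding lands in the dual of \<open>S 2\<close>, where it evaluates \<tau>; the remaining
  \<open>n - 1\<close> embeddings lift both sides in parallel.\<close>

lemma ev_canon_iter_bidual:
  assumes "1 \<le> n" "2 * n + 1 \<le> m" "f \<in> S 1" "\<tau> \<in> S 2"
  shows "ev (2 * n) (canon_iter S ev 1 n f) (canon_iter S ev 2 (n - 1) \<tau>) = ev 1 \<tau> f"
proof -
  obtain j where j: "n = Suc j" using assms(1) by (cases n) auto
  have f: "canon S ev 1 f \<in> S 3"
    by (rule contraction_onD(2)[OF contraction_canon[of 1 3] assms(3)]) (use j assms in simp_all)
  have "ev (2 + 2 * j) (canon_iter S ev (Suc 2) j (canon S ev 1 f)) (canon_iter S ev 2 j \<tau>)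
      = ev 2 (canon S ev 1 f) \<tau>"
    by (rule ev_canon_iter) (use f j assms in \<open>simp_all add: eval_nat_numeral\<close>)
  also have "\<dots> = ev 1 \<tau> f"
    by (rule ev_canon) (use j assms in simp_all)
  finally show ?thesis
    unfolding j canon_iter_Suc_shift by (simp add: eval_nat_numeral)
qed

text \<open>For \<open>G = \<Lambda> - ?J f\<close> and a point of \<open>S 0\<close> at distance
  \<open>d < norm \<tau>\<close> from \<tau>, one has
  \<open>norm \<tau> \<le> norm \<tau> * norm f + norm G * d\<close>, while
  \<open>norm f + norm G \<le> 1\<close>. This forces \<open>G = 0\<close>.\<close>

lemma norming_functional_in_predual:
  assumes n: "1 \<le> n" "2 * n + 1 \<le> m" and L: "L_split n"
    and \<tau>: "\<tau> \<in> S 2" "infdist \<tau> (canon S ev 0 ` S 0) < norm \<tau>"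
    and \<Lambda>: "\<Lambda> \<in> S (2 * n + 1)" "norm \<Lambda> \<le> 1"
      "ev (2 * n) \<Lambda> (canon_iter S ev 2 (n - 1) \<tau>) = complex_of_real (norm \<tau>)"
  obtains f where "f \<in> S 1" "norm f \<le> 1" "ev 1 \<tau> f = complex_of_real (norm \<tau>)"
    "\<Lambda> = canon_iter S ev 1 n f"
proof -
  let ?J = "canon_iter S ev 1 n" and ?\<iota> = "canon_iter S ev 0 n" and ?c = "canon_iter S ev 2 (n - 1)"
  interpret p0: dual_pair "S 0" "S 1" "ev 0" by (rule dual_pair) (use n in simp_all)
  interpret p1: dual_pair "S 1" "S 2" "ev 1" by (rule dual_pair) (use n in simp_all)
  interpret a: dual_pair "S (2 * n)" "S (2 * n + 1)" "ev (2 * n)" by (rule dual_pair) (use n in simp_all)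
  have c: "contraction_on (S 2) (S (2 * n)) ?c"
    by (rule contraction_canon_iter_bidual) (use n in simp_all)
  have J: "contraction_on (S 1) (S (2 * n + 1)) ?J"
    using contraction_canon_iter[of 1 n] n by simp
  note c = contraction_onD[OF c] and J = contraction_onD[OF J]
  obtain x where x: "x \<in> S 0" "norm (\<tau> - canon S ev 0 x) < norm \<tau>"
  proof -
    have ne: "canon S ev 0 ` S 0 \<noteq> {}" using csubspaceD(1)[OF p0.csubspace] by auto
    then have "\<not> (\<forall>y\<in>canon S ev 0 ` S 0. norm \<tau> \<le> dist \<tau> y)"
      using \<tau>(2) cINF_greatest[OF ne, of "norm \<tau>" "dist \<tau>"] by (auto simp: infdist_notempty)
    then show thesis using that by (auto simp: dist_norm not_le)
  qed
  have x2: "canon S ev 0 x \<in> S 2"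
    by (rule contraction_onD(2)[OF contraction_canon[of 0 2] x(1)]) (use n in simp_all)
  have iota: "?\<iota> x = ?c (canon S ev 0 x)"
    using canon_iter_Suc_shift[of 0 "n - 1" x] n(1) by (simp add: eval_nat_numeral)
  obtain f where f: "f \<in> S 1" "norm f + norm (\<Lambda> - ?J f) \<le> norm \<Lambda>"
      "\<And>x. x \<in> S 0 \<Longrightarrow> ev (2 * n) \<Lambda> (?\<iota> x) = ev 0 f x"
    using L \<Lambda>(1) unfolding L_split_def by auto
  define G where "G = \<Lambda> - ?J f"
  have G: "G \<in> S (2 * n + 1)"
    unfolding G_def using csubspace_diff[OF a.csubspace_dual \<Lambda>(1) J(2)[OF f(1)]] .
  have evG: "ev (2 * n) G y = ev (2 * n) \<Lambda> y - ev (2 * n) (?J f) y" if "y \<in> S (2 * n)" for y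
    unfolding G_def using clinear_on_diff[OF a.clinear_evaluation[OF that] a.csubspace_dual \<Lambda>(1) J(2)[OF f(1)]] .
  have ev\<tau>: "ev (2 * n) (?J f) (?c \<tau>) = ev 1 \<tau> f"
    using ev_canon_iter_bidual[OF n f(1) \<tau>(1)] .
  have "ev (2 * n) G (?\<iota> x) = 0"
  proof -
    have "ev (0 + 2 * n) (canon_iter S ev (Suc 0) n f) (?\<iota> x) = ev 0 f x"
      by (rule ev_canon_iter) (use n f(1) x(1) in simp_all)
    then show ?thesis
      using evG[of "?\<iota> x"] f(3)[OF x(1)] c(2)[OF x2] iota by simp
  qed
  \<comment> \<open>\<open>G\<close> vanishes on the copy of \<open>S 0\<close>, so \<tau> may be
    replaced by its difference from \<open>x\<close>, which is shorter.\<close>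
  then have "ev (2 * n) G (?c \<tau>) = ev (2 * n) G (?c (\<tau> - canon S ev 0 x))"
    using clinear_on_diff[OF c(1) p1.csubspace_dual \<tau>(1) x2]
      clinear_on_diff[OF a.clinear_functional[OF G] a.csubspace c(2)[OF \<tau>(1)] c(2)[OF x2]] iota
    by simp
  then have bound: "cmod (ev (2 * n) G (?c \<tau>)) \<le> norm G * norm (\<tau> - canon S ev 0 x)"
    using a.ev_bound[OF G c(2)[OF csubspace_diff[OF p1.csubspace_dual \<tau>(1) x2]]]
      mult_left_mono[OF c(3)[OF csubspace_diff[OF p1.csubspace_dual \<tau>(1) x2]], of "norm G"] by simp
  have fb: "cmod (ev 1 \<tau> f) \<le> norm \<tau> * norm f"
    using p1.ev_bound[OF \<tau>(1) f(1)] .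
  have "complex_of_real (norm \<tau>) = ev 1 \<tau> f + ev (2 * n) G (?c \<tau>)"
    using evG[OF c(2)[OF \<tau>(1)]] ev\<tau> \<Lambda>(3) by simp
  then have "norm \<tau> \<le> cmod (ev 1 \<tau> f) + cmod (ev (2 * n) G (?c \<tau>))"
    by (metis norm_triangle_ineq norm_of_real abs_norm_cancel)
  then have "norm \<tau> \<le> norm \<tau> * norm f + norm G * norm (\<tau> - canon S ev 0 x)"
    using bound fb by linarith
  moreover have "norm \<tau> * (norm f + norm G) \<le> norm \<tau> * 1"
    using f(2) \<Lambda>(2) by (intro mult_left_mono) (auto simp: G_def)
  ultimately have "norm G * (norm \<tau> - norm (\<tau> - canon S ev 0 x)) \<le> 0"
    by (simp add: algebra_simps)
  then have "G = 0"
    using x(2) by (simp add: mult_le_0_iff)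
  then have "\<Lambda> = ?J f" by (simp add: G_def)
  then show thesis
    using that[of f] f(1,2) \<Lambda>(2,3) ev\<tau> by simp
qed

text \<open>The real part of the evaluation at \<tau> attains a maximum on the weak*-compact unit
  ball of \<open>S 3\<close>. This ball contains the canonical image of the unit ball of
  \<open>S 1\<close>, over which the norm of \<tau> is the supremum.\<close>

lemma norming_functional_exists:
  assumes m: "3 \<le> m" and \<tau>: "\<tau> \<in> S 2"
  obtains \<Lambda> where "\<Lambda> \<in> S 3" "norm \<Lambda> \<le> 1" "ev 2 \<Lambda> \<tau> = complex_of_real (norm \<tau>)"
proof -
  interpret p1: dual_pair "S 1" "S 2" "ev 1" by (rule dual_pair) (use m in simp_all)
  interpret p2: dual_pair "S 2" "S 3" "ev 2" by (rule dual_pair) (use m in simp_all)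
  let ?B = "{\<Lambda>\<in>S 3. norm \<Lambda> \<le> 1}"
  have "continuous_map euclidean euclideanreal Re"
    using linear_continuous_on[OF bounded_linear_Re] by simp
  from continuous_map_compose[OF p2.continuous_map_ev[OF \<tau>] this]
  have "continuous_map p2.weak euclideanreal (\<lambda>\<Lambda>. Re (ev 2 \<Lambda> \<tau>))"
    by (simp add: o_def)
  from image_compactin[OF p2.Banach_Alaoglu this]
  have "compact ((\<lambda>\<Lambda>. Re (ev 2 \<Lambda> \<tau>)) ` ?B)"
    by simp
  moreover have "?B \<noteq> {}"
    using csubspaceD(1)[OF p2.csubspace_dual] by auto
  ultimately obtain \<Lambda> where \<Lambda>: "\<Lambda> \<in> ?B" "\<And>G. G \<in> ?B \<Longrightarrow> Re (ev 2 G \<tau>) \<le> Re (ev 2 \<Lambda> \<tau>)"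
    using compact_attains_sup[of "(\<lambda>\<Lambda>. Re (ev 2 \<Lambda> \<tau>)) ` ?B"] by blast
  have "norm \<tau> \<le> Re (ev 2 \<Lambda> \<tau>)"
  proof (rule p1.norm_le_Re[OF \<tau>])
    fix f assume f: "f \<in> S 1" "norm f \<le> 1"
    have c: "contraction_on (S 1) (S 3) (canon S ev 1)"
      by (rule contraction_canon) (use m in simp_all)
    have e: "ev 2 (canon S ev 1 f) \<tau> = ev 1 \<tau> f"
      by (rule ev_canon) (use m f \<tau> in simp_all)
    have "canon S ev 1 f \<in> ?B"
      using contraction_onD(2,3)[OF c f(1)] f(2) by simp
    then show "Re (ev 1 \<tau> f) \<le> Re (ev 2 \<Lambda> \<tau>)"
      using \<Lambda>(2) e by metis
  qed
  moreover have "cmod (ev 2 \<Lambda> \<tau>) \<le> norm \<tau>"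
    using p2.ev_bound[of \<Lambda> \<tau>] \<Lambda>(1) \<tau> mult_right_mono[of "norm \<Lambda>" 1 "norm \<tau>"] by auto
  ultimately show thesis
    using that \<Lambda>(1) complex_eq_of_real_if_Re_ge by blast
qed

text \<open>The norming functionals of \<tau> form a face of the unit ball of \<open>S 1\<close>,
  and \<open>?J\<close> is injective and linear. So a proper segment of the ball through
  \<open>f\<close> would give a proper segment of \<open>?K\<close> through
  \<open>p\<close>.\<close>

lemma extreme_norming_functional:
  assumes n: "1 \<le> n" "2 * n + 1 \<le> m" and L: "L_split n"
    and \<tau>: "\<tau> \<in> S 2" "infdist \<tau> (canon S ev 0 ` S 0) < norm \<tau>"
    and p: "p extreme_point_of {\<Lambda>\<in>S (2 * n + 1). norm \<Lambda> \<le> 1 \<and>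
        ev (2 * n) \<Lambda> (canon_iter S ev 2 (n - 1) \<tau>) = complex_of_real (norm \<tau>)}"
      (is "p extreme_point_of ?K")
  obtains f where "f extreme_point_of {f\<in>S 1. norm f \<le> 1}" "ev 1 \<tau> f = complex_of_real (norm \<tau>)"
    "p = canon_iter S ev 1 n f"
proof -
  let ?J = "canon_iter S ev 1 n" and ?B = "{f\<in>S 1. norm f \<le> 1}"
  interpret p0: dual_pair "S 0" "S 1" "ev 0" by (rule dual_pair) (use n in simp_all)
  interpret p1: dual_pair "S 1" "S 2" "ev 1" by (rule dual_pair) (use n in simp_all)
  have J: "contraction_on (S 1) (S (2 * n + 1)) ?J"
    using contraction_canon_iter[of 1 n] n by simp
  note J = contraction_onD[OF J]
  \<comment> \<open>Restriction to the copy of \<open>S 0\<close> recovers a functional from its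
    image.\<close>
  have inj: "a = b" if "a \<in> S 1" "b \<in> S 1" "?J a = ?J b" for a b
  proof (rule p0.functional_eqI[OF that(1,2)])
    fix x assume "x \<in> S 0"
    then have "ev (0 + 2 * n) (canon_iter S ev (Suc 0) n f) (canon_iter S ev 0 n x) = ev 0 f x"
      if "f \<in> S 1" for f
      by (intro ev_canon_iter) (use n that in simp_all)
    then show "ev 0 a x = ev 0 b x"
      using that by (metis One_nat_def)
  qed
  obtain f where f: "f \<in> S 1" "norm f \<le> 1" "ev 1 \<tau> f = complex_of_real (norm \<tau>)" "p = ?J f"
    using norming_functional_in_predual[OF n L \<tau>, of p] p by (auto simp: extreme_point_of_def)
  have "f \<notin> open_segment a b" if ab: "a \<in> ?B" "b \<in> ?B" for a b
  proof
    assume "f \<in> open_segment a b"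
    then obtain t where t: "0 < t" "t < 1" "f = (1 - t) *\<^sub>R a + t *\<^sub>R b" "a \<noteq> b"
      by (auto simp: in_segment)
    have norming: "cmod (ev 1 \<tau> c) \<le> norm \<tau>" if "c \<in> ?B" for c
      using p1.ev_bound[OF \<tau>(1), of c] mult_left_mono[of "norm c" 1 "norm \<tau>"] that by auto
    have sc: "r *\<^sub>R a \<in> S 1" "r *\<^sub>R b \<in> S 1" for r
      using ab csubspaceD(4)[OF p1.csubspace] by auto
    have mix: "g f = (1 - t) *\<^sub>R g a + t *\<^sub>R g b" if "clinear_on (S 1) g" for g :: "'u \<Rightarrow> 'v::complex_banach"
      unfolding t(3) using clinear_onD[OF that] ab sc by simp
    have "norm \<tau> = (1 - t) * Re (ev 1 \<tau> a) + t * Re (ev 1 \<tau> b)"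
      using arg_cong[OF mix[OF p1.clinear_functional[OF \<tau>(1)]], of Re] f(3) by simp
    \<comment> \<open>A weighted mean of two numbers that are at most \<open>norm \<tau>\<close>
      equals \<open>norm \<tau>\<close> only if both do.\<close>
    then have "(1 - t) * (norm \<tau> - Re (ev 1 \<tau> a)) + t * (norm \<tau> - Re (ev 1 \<tau> b)) = 0"
      by (simp add: algebra_simps)
    moreover have "0 \<le> (1 - t) * (norm \<tau> - Re (ev 1 \<tau> a))" "0 \<le> t * (norm \<tau> - Re (ev 1 \<tau> b))"
      using t(1,2) norming[OF ab(1)] norming[OF ab(2)] complex_Re_le_cmod[of "ev 1 \<tau> a"]
        complex_Re_le_cmod[of "ev 1 \<tau> b"] by (auto intro!: mult_nonneg_nonneg)
    ultimately have "(1 - t) * (norm \<tau> - Re (ev 1 \<tau> a)) = 0" "t * (norm \<tau> - Re (ev 1 \<tau> b)) = 0"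
      by linarith+
    then have "ev 1 \<tau> a = complex_of_real (norm \<tau>)" "ev 1 \<tau> b = complex_of_real (norm \<tau>)"
      using t(1,2) norming ab by (auto intro!: complex_eq_of_real_if_Re_ge)
    then have "?J a \<in> ?K" "?J b \<in> ?K"
      using ab J(2,3) ev_canon_iter_bidual[OF n _ \<tau>(1)] by (auto intro: order_trans)
    moreover have "p \<in> open_segment (?J a) (?J b)"
      using mix[OF J(1)] inj[of a b] ab t f(4) by (auto simp: in_segment)
    ultimately show False
      using p by (auto simp: extreme_point_of_def)
  qed
  then have "f extreme_point_of ?B"
    using f by (auto simp: extreme_point_of_def)
  then show thesis using that f by blast
qed

end

section \<open>Norm attainment and the subdifferential of \<tau>\<close>

theorem proposition10:
  fixes S :: "nat \<Rightarrow> 'u::complex_banach set"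
    and ev :: "nat \<Rightarrow> 'u \<Rightarrow> 'u \<Rightarrow> complex"
    and n :: nat
    and \<tau> :: 'u
  assumes "n \<ge> 1"
    and "dual_tower S ev (2 * n + 1)"
    and "M_ideal (canon S ev 0 ` S 0) (S 2) (S 3) (ev 2)"
    and "\<tau> \<in> S 2"
    and "infdist \<tau> (canon S ev 0 ` S 0) < norm \<tau>"
  shows "(\<exists>g\<in>S 1. norm g = 1 \<and> ev 1 \<tau> g = complex_of_real (norm \<tau>)) \<and>
    {\<Lambda>\<in>S (2 * n + 1). norm \<Lambda> = 1 \<and>
        ev (2 * n) \<Lambda> (canon_iter S ev 2 (n - 1) \<tau>) = complex_of_real (norm \<tau>)} =
    weak_star (S (2 * n)) (S (2 * n + 1)) (ev (2 * n)) closure_of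
      (convex hull (canon_iter S ev 1 n `
        {f. f extreme_point_of {f\<in>S 1. norm f \<le> 1} \<and> ev 1 \<tau> f = complex_of_real (norm \<tau>)}))"
proof -
  interpret tower S ev "2 * n + 1" by standard fact
  interpret p1: dual_pair "S 1" "S 2" "ev 1" by (rule dual_pair) (use assms(1) in simp_all)
  interpret a: dual_pair "S (2 * n)" "S (2 * n + 1)" "ev (2 * n)" by (rule dual_pair) simp_all
  let ?J = "canon_iter S ev 1 n" and ?\<tau> = "canon_iter S ev 2 (n - 1) \<tau>"
  let ?X = "{f. f extreme_point_of {f\<in>S 1. norm f \<le> 1} \<and> ev 1 \<tau> f = complex_of_real (norm \<tau>)}"
  \<comment> \<open>The bound \<open>norm \<Lambda> \<le> 1\<close> makes \<open>K\<close> convex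
    and weak*-compact; since \<open>norm \<tau>\<close> is positive, norming \<tau> forces
    equality.\<close>
  define K where "K = {\<Lambda>\<in>S (2 * n + 1). norm \<Lambda> \<le> 1 \<and> ev (2 * n) \<Lambda> ?\<tau> = complex_of_real (norm \<tau>)}"
  have pos: "0 < norm \<tau>"
    using assms(5) infdist_nonneg le_less_trans by blast
  have norm1: "norm f = 1" if "norm f \<le> 1" "norm \<tau> \<le> norm f * norm \<tau>" for f :: 'u
    using that pos by simp
  have split: "L_split 1" "L_split n"
    using L_split assms(1,3) by auto
  have c: "contraction_on (S 2) (S (2 * n)) (canon_iter S ev 2 (n - 1))"
    by (rule contraction_canon_iter_bidual) (use assms(1) in simp_all)
  note c = contraction_onD[OF c]
  have J: "contraction_on (S 1) (S (2 * n + 1)) ?J"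
    using contraction_canon_iter[of 1 n] by simp
  note J = contraction_onD[OF J]
  have "\<exists>g\<in>S 1. norm g = 1 \<and> ev 1 \<tau> g = complex_of_real (norm \<tau>)"
  proof -
    \<comment> \<open>Level 3 exists because \<open>n \<ge> 1\<close>; by \<open>L_split 1\<close> a
      norming functional found there is the canonical image of one in \<open>S 1\<close>.\<close>
    obtain \<Lambda> where \<Lambda>: "\<Lambda> \<in> S 3" "norm \<Lambda> \<le> 1" "ev 2 \<Lambda> \<tau> = complex_of_real (norm \<tau>)"
      using norming_functional_exists[OF _ assms(4)] assms(1) by auto
    obtain f where f: "f \<in> S 1" "norm f \<le> 1" "ev 1 \<tau> f = complex_of_real (norm \<tau>)"
      using norming_functional_in_predual[OF _ _ split(1) assms(4,5), of \<Lambda>] \<Lambda> assms(1)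
      by (auto simp: numeral_3_eq_3)
    have "norm f = 1"
      using p1.ev_bound[OF assms(4) f(1)] f by (intro norm1) (auto simp: mult.commute)
    then show ?thesis using f by blast
  qed
  moreover have "{\<Lambda>\<in>S (2 * n + 1). norm \<Lambda> = 1 \<and> ev (2 * n) \<Lambda> ?\<tau> = complex_of_real (norm \<tau>)} = K"
  proof -
    have "norm \<Lambda> = 1" if "\<Lambda> \<in> K" for \<Lambda>
    proof -
      have "norm \<tau> \<le> norm \<Lambda> * norm ?\<tau>"
        using a.ev_bound[of \<Lambda> ?\<tau>] c(2)[OF assms(4)] that by (auto simp: K_def)
      also have "\<dots> \<le> norm \<Lambda> * norm \<tau>"
        using c(3)[OF assms(4)] by (intro mult_left_mono) auto
      finally show ?thesis
        using that by (intro norm1) (auto simp: K_def)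
    qed
    then show ?thesis by (auto simp: K_def)
  qed
  moreover have "a.weak closure_of (convex hull (?J ` ?X)) = K"
  proof
    have K: "compactin a.weak K" "convex K"
      unfolding K_def using a.compactin_norming a.convex_norming c(2)[OF assms(4)] by auto
    have "?J ` ?X \<subseteq> K"
      using J(2,3) ev_canon_iter_bidual[OF assms(1) _ _ assms(4)]
      by (auto simp: K_def extreme_point_of_def intro: order_trans)
    then have "convex hull (?J ` ?X) \<subseteq> K"
      using K(2) by (rule hull_minimal)
    then show "a.weak closure_of (convex hull (?J ` ?X)) \<subseteq> K"
      using compactin_imp_closedin[OF a.Hausdorff_weak K(1)] by (rule closure_of_minimal)
    have "{p. p extreme_point_of K} \<subseteq> ?J ` ?X"
      unfolding K_def
      using extreme_norming_functional[OF assms(1) _ split(2) assms(4,5)] by blast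
    then have "a.weak closure_of (convex hull {p. p extreme_point_of K}) \<subseteq> a.weak closure_of (convex hull (?J ` ?X))"
      by (intro closure_of_mono hull_mono)
    then show "K \<subseteq> a.weak closure_of (convex hull (?J ` ?X))"
      using a.weak_closure_hull_extreme_points[OF K] by simp
  qed
  ultimately show ?thesis by simp
qed

end
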